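(* Let $C$ be one of the eight three-edge configurations. If some order-$18$ Leech tree has $C$, up to weighted-tree isomorphism, as its three smallest-weight physical edges, then the search rooted at $C$ reaches an accepting leaf.
   Context: Leech trees. A Leech tree of order $n$ is a finite simple tree $T=(V,E,w)$ with $|V|=n$ and positive integer edge weights such that the weighted distances $d_T(x,y)$, indexed by unordered pairs of distinct vertices, are exactly $1,\ldots,\binom n2$, each once. Physical edges are the edges of $T$; their weights are pairwise distinct. For $n=18$, $\binom n2=153$; put $I_{153}=\{1,\ldots,153\}$. Isomorphisms of weighted trees or forests are vertex bijections preserving adjacency and edge weights. Configurations. The eight three-edge configurations are the following weighted forests, each regarded as a forest on $18$ vertices by adding isolated vertices: (1) a path with successive edge weights $1,2$ and a separate edge of weight $4$; (2) a path with successive weights $4,1,2$; (3) a path with successive weights $1,2,4$; (4) a star with weights $1,2,4$; (5) three separate edges with weights $1,2,3$; (6) a path with successive weights $1,3$ and a separate edge of weight $2$; (7) a separate edge of weight $1$ and a path with successive weights $2,3$; (8) a path with successive weights $1,3,2$. Separate means vertex-disjoint. Search states. A state is a forest on a fixed set of $18$ vertices with positive integer edge weights (its edges are called exposed; isolated vertices are singleton components) that is valid: its internal distances, i.e. the weighted distances between two distinct vertices in a common component, indexed by unordered pairs and taken over all components together, are pairwise distinct and lie in $I_{153}$. Write $D$ for its set of internal distances. Search rooted at $C$. The search begins with the state $C$. At a state with fewer than $17$ exposed edges, let $m$ be the least positive integer not in $D$ (the forced weight). Candidate extensions are obtained by choosing two distinct components and one attachment vertex in each, and adding an edge of weight $m$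 joining these two vertices. The group of automorphisms of the weighted forest (vertex permutations preserving adjacency and exposed edge weights) acts on candidate extensions, and exactly one representative of each orbit is retained. A retained child is discarded if one of the following tests rejects it, and otherwise is searched recursively in the same way: (i) two internal distances (of different vertex pairs) are equal; (ii) an internal distance lies outside $I_{153}$; (iii) the $7/11$ parity profile is impossible: each component is partitioned into two (possibly empty) classes according to the parity of the distance from a fixed vertex of the component; the test rejects if and only if there is no way of naming, independently in each component, one of its classes "first" and the other "second" so that the total sizes of the first and second classes are $7$ and $11$ in some order; (iv) two vertices in one component are joined by an exposed path with more than $14$ edges; (v) the component-pair whole-block test: for components $K_i,K_j$ ($i<j$), a candidate block is a set $\{d_i(x,p)+L+d_j(p',y):x\in K_i,\,y\in K_j\}$, with $p\in K_i$, $p'\in K_j$, $L\ge1$ an integer and $d_i$ the weighted distance inside $K_i$, having exactly $|K_i||K_j|$ elements and contained in $H=I_{153}\setminus D$. This test rejects if some component pair has no candidate block, or if an exhaustive search carried out within its resource budget establishes that one cannot choose one candidate block for each component pair with the chosen blocks pairwise disjoint. That global search may be run only at selected component counts; if it is not run, or exhausts its candidate cap or budget, the state is not rejected on its account. An accepting leaf is a valid state with $17$ exposed edges reached by the search (so it is a tree on $18$ vertices whose $153$ distances are pairwise distinct and lie in $I_{153}$). *)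

theory Defs
  imports Main "HOL-Library.Disjoint_Sets"
begin

text \<open>
  The edges of a weighted graph are the unordered pairs on which the weight map is defined.
\<close>

record 'a wgraph =
  verts :: "'a set"
  wt :: "'a set \<Rightarrow> nat option"

definition edges :: "'a wgraph \<Rightarrow> 'a set set" where
  "edges G = dom (wt G)"

definition simple_wgraph :: "'a wgraph \<Rightarrow> bool" where
  "simple_wgraph G \<longleftrightarrow>
     finite (verts G) \<and>
     (\<forall>e\<in>edges G. \<exists>u\<in>verts G. \<exists>v\<in>verts G. u \<noteq> v \<and> e = {u, v}) \<and>
     (\<forall>e\<in>edges G. the (wt G e) > 0)"

definition path :: "'a wgraph \<Rightarrow> 'a list \<Rightarrow> bool" where
  "path G p \<longleftrightarrow>
     p \<noteq> [] \<and> distinct p \<and> set p \<subseteq> verts G \<and> successively (\<lambda>u v. {u, v} \<in> edges G) p"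

definition cycle :: "'a wgraph \<Rightarrow> 'a list \<Rightarrow> bool" where
  "cycle G p \<longleftrightarrow> path G p \<and> length p \<ge> 3 \<and> {last p, hd p} \<in> edges G"

definition joined :: "'a wgraph \<Rightarrow> 'a \<Rightarrow> 'a \<Rightarrow> bool" where
  "joined G x y \<longleftrightarrow> (\<exists>p. path G p \<and> hd p = x \<and> last p = y)"

definition forest :: "'a wgraph \<Rightarrow> bool" where
  "forest G \<longleftrightarrow> simple_wgraph G \<and> \<not> (\<exists>p. cycle G p)"

definition tree :: "'a wgraph \<Rightarrow> bool" where
  "tree G \<longleftrightarrow> forest G \<and> verts G \<noteq> {} \<and> (\<forall>x\<in>verts G. \<forall>y\<in>verts G. joined G x y)"

definition components :: "'a wgraph \<Rightarrow> 'a set set" where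
  "components G = (\<lambda>x. {y \<in> verts G. joined G x y}) ` verts G"

definition path_weight :: "'a wgraph \<Rightarrow> 'a list \<Rightarrow> nat" where
  "path_weight G p = (\<Sum>(u, v)\<leftarrow>zip p (tl p). the (wt G {u, v}))"

text \<open>
  The distance between \<open>x\<close> and \<open>y\<close> is \<open>wdist G {x, y}\<close>; it is taken on the unordered pair, and
  \<open>wdist G {x, x} = 0\<close> because of the one-vertex path. It is meaningful only when \<open>x\<close> and \<open>y\<close> lie
  in a common component.
\<close>

definition wdist :: "'a wgraph \<Rightarrow> 'a set \<Rightarrow> nat" where
  "wdist G e = (LEAST d. \<exists>p. path G p \<and> {hd p, last p} = e \<and> path_weight G p = d)"

definition isomorphism :: "('a \<Rightarrow> 'b) \<Rightarrow> 'a wgraph \<Rightarrow> 'b wgraph \<Rightarrow> bool" where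
  "isomorphism f G H \<longleftrightarrow>
     bij_betw f (verts G) (verts H) \<and>
     (\<forall>u\<in>verts G. \<forall>v\<in>verts G.
        ({f u, f v} \<in> edges H \<longleftrightarrow> {u, v} \<in> edges G) \<and>
        ({u, v} \<in> edges G \<longrightarrow> the (wt H {f u, f v}) = the (wt G {u, v})))"

definition isomorphic :: "'a wgraph \<Rightarrow> 'b wgraph \<Rightarrow> bool" where
  "isomorphic G H \<longleftrightarrow> (\<exists>f. isomorphism f G H)"

definition leech_tree :: "nat \<Rightarrow> 'a wgraph \<Rightarrow> bool" where
  "leech_tree n T \<longleftrightarrow>
     tree T \<and> card (verts T) = n \<and>
     bij_betw (wdist T) {e. e \<subseteq> verts T \<and> card e = 2} {1..n choose 2}"

definition smallest_edges :: "nat \<Rightarrow> 'a wgraph \<Rightarrow> 'a wgraph \<Rightarrow> bool" where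
  "smallest_edges k G H \<longleftrightarrow>
     (\<exists>S \<subseteq> edges G. card S = k \<and>
        (\<forall>e\<in>S. \<forall>f\<in>edges G - S. the (wt G e) < the (wt G f)) \<and>
        H = G\<lparr>wt := wt G |` S\<rparr>)"

definition forest18 :: "(nat \<times> nat \<times> nat) list \<Rightarrow> nat wgraph" where
  "forest18 es = \<lparr>verts = {..<18}, wt = map_of (map (\<lambda>(u, v, k). ({u, v}, k)) es)\<rparr>"

definition configurations :: "nat wgraph set" where
  "configurations = forest18 `
     {[(0, 1, 1), (1, 2, 2), (3, 4, 4)],
      [(0, 1, 4), (1, 2, 1), (2, 3, 2)],
      [(0, 1, 1), (1, 2, 2), (2, 3, 4)],
      [(0, 1, 1), (0, 2, 2), (0, 3, 4)],
      [(0, 1, 1), (2, 3, 2), (4, 5, 3)],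
      [(0, 1, 1), (1, 2, 3), (3, 4, 2)],
      [(0, 1, 1), (2, 3, 2), (3, 4, 3)],
      [(0, 1, 1), (1, 2, 3), (2, 3, 2)]}"

definition internal_pairs :: "'a wgraph \<Rightarrow> 'a set set" where
  "internal_pairs F = {{x, y} | x y. \<exists>K\<in>components F. x \<in> K \<and> y \<in> K \<and> x \<noteq> y}"

definition internal_dists :: "'a wgraph \<Rightarrow> nat set" where
  "internal_dists F = wdist F ` internal_pairs F"

definition search_state :: "nat wgraph \<Rightarrow> bool" where
  "search_state F \<longleftrightarrow>
     verts F = {..<18} \<and> forest F \<and>
     inj_on (wdist F) (internal_pairs F) \<and> internal_dists F \<subseteq> {1..153}"

definition forced_weight :: "nat wgraph \<Rightarrow> nat" where
  "forced_weight F = (LEAST m. 0 < m \<and> m \<notin> internal_dists F)"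

text \<open>
  A candidate extension is given by the new edge alone, since its weight is forced. On candidates
  so represented, an automorphism \<open>f\<close> acts by \<open>e \<mapsto> f ` e\<close>.
\<close>

definition candidates :: "nat wgraph \<Rightarrow> nat set set" where
  "candidates F =
     {{u, v} | u v. \<exists>K\<in>components F. \<exists>K'\<in>components F. K \<noteq> K' \<and> u \<in> K \<and> v \<in> K'}"

definition extend :: "nat wgraph \<Rightarrow> nat set \<Rightarrow> nat wgraph" where
  "extend F e = F\<lparr>wt := (wt F)(e \<mapsto> forced_weight F)\<rparr>"

definition orbit :: "nat wgraph \<Rightarrow> nat set \<Rightarrow> nat set set" where
  "orbit F e = {f ` e | f. isomorphism f F F}"

definition orbit_representatives :: "nat wgraph \<Rightarrow> nat set set \<Rightarrow> bool" where
  "orbit_representatives F R \<longleftrightarrow>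
     R \<subseteq> candidates F \<and> (\<forall>e\<in>candidates F. \<exists>!e'. e' \<in> R \<and> e' \<in> orbit F e)"

text \<open>
  The fixed vertex of \<open>K\<close> is \<open>SOME r. r \<in> K\<close>. A naming \<open>s\<close> calls the even class of \<open>K\<close> first if
  \<open>s K\<close>, and the odd class first otherwise.
\<close>

definition parity_class :: "nat wgraph \<Rightarrow> nat set \<Rightarrow> bool \<Rightarrow> nat set" where
  "parity_class F K b = {x \<in> K. even (wdist F {SOME r. r \<in> K, x}) \<longleftrightarrow> b}"

definition parity_profile_possible :: "nat wgraph \<Rightarrow> bool" where
  "parity_profile_possible F \<longleftrightarrow>
     (\<exists>s :: nat set \<Rightarrow> bool.
        ((\<Sum>K\<in>components F. card (parity_class F K (s K))),
         (\<Sum>K\<in>components F. card (parity_class F K (\<not> s K)))) \<in> {(7, 11), (11, 7)})"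

definition has_long_path :: "nat wgraph \<Rightarrow> bool" where
  "has_long_path F \<longleftrightarrow> (\<exists>p. path F p \<and> length p - 1 > 14)"

text \<open>
  Pairs of components are unordered. Exchanging the two components, together with \<open>p\<close> and \<open>p'\<close>,
  does not change the block, so \<open>candidate_blocks\<close> is well defined on unordered pairs.
\<close>

definition component_pairs :: "nat wgraph \<Rightarrow> nat set set set" where
  "component_pairs F = {P. P \<subseteq> components F \<and> card P = 2}"

definition block :: "nat wgraph \<Rightarrow> nat set \<Rightarrow> nat set \<Rightarrow> nat \<Rightarrow> nat \<Rightarrow> nat \<Rightarrow> nat set" where
  "block F K K' p p' L = {wdist F {x, p} + L + wdist F {p', y} | x y. x \<in> K \<and> y \<in> K'}"

definition candidate_blocks :: "nat wgraph \<Rightarrow> nat set set \<Rightarrow> nat set set" where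
  "candidate_blocks F P =
     {B. \<exists>K K' p p' L. P = {K, K'} \<and> K \<noteq> K' \<and> p \<in> K \<and> p' \<in> K' \<and> L \<ge> 1 \<and>
           B = block F K K' p p' L \<and>
           card B = card K * card K' \<and> B \<subseteq> {1..153} - internal_dists F}"

definition disjoint_blocks_exist :: "nat wgraph \<Rightarrow> bool" where
  "disjoint_blocks_exist F \<longleftrightarrow>
     (\<exists>\<beta>. (\<forall>P\<in>component_pairs F. \<beta> P \<in> candidate_blocks F P) \<and>
          disjoint_family_on \<beta> (component_pairs F))"

text \<open>
  \<open>decided F\<close> means that the global search for disjoint blocks is run at \<open>F\<close> and finishes within
  its candidate cap and resource budget. The predicate is left arbitrary, so every policy for when
  to run that search and with which limits is covered. A predicate of the state is general enough:
  a run adds edges of increasing weight, so a state determines the branch leading to it.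
\<close>

definition block_test_rejects :: "(nat wgraph \<Rightarrow> bool) \<Rightarrow> nat wgraph \<Rightarrow> bool" where
  "block_test_rejects decided F \<longleftrightarrow>
     (\<exists>P\<in>component_pairs F. candidate_blocks F P = {}) \<or>
     (decided F \<and> \<not> disjoint_blocks_exist F)"

definition rejected :: "(nat wgraph \<Rightarrow> bool) \<Rightarrow> nat wgraph \<Rightarrow> bool" where
  "rejected decided F \<longleftrightarrow>
     \<not> inj_on (wdist F) (internal_pairs F) \<or>
     \<not> internal_dists F \<subseteq> {1..153} \<or>
     \<not> parity_profile_possible F \<or>
     has_long_path F \<or>
     block_test_rejects decided F"

text \<open>
  \<open>retained F\<close> is the set of orbit representatives kept at \<open>F\<close>. The root is not tested.
\<close>

inductive reached ::
  "(nat wgraph \<Rightarrow> nat set set) \<Rightarrow> (nat wgraph \<Rightarrow> bool) \<Rightarrow> nat wgraph \<Rightarrow> nat wgraph \<Rightarrow> bool"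
  for retained decided C
where
  root: "reached retained decided C C"
| child: "reached retained decided C F \<Longrightarrow> card (edges F) < 17 \<Longrightarrow> e \<in> retained F \<Longrightarrow>
    \<not> rejected decided (extend F e) \<Longrightarrow> reached retained decided C (extend F e)"

definition accepting_leaf :: "nat wgraph \<Rightarrow> bool" where
  "accepting_leaf F \<longleftrightarrow> search_state F \<and> card (edges F) = 17"

end

theory Submission
  imports Defs
begin

text \<open>
  The search always has a child that lies inside some Leech tree \<open>T\<close> on its vertex set. If \<open>F\<close> is
  a proper subforest of \<open>T\<close>, the forced weight of \<open>F\<close> is the weight of an edge of \<open>T\<close>; the
  representative of this edge is its image under an automorphism \<open>f\<close> of \<open>F\<close>, so one continues with
  \<open>f(T)\<close> instead of \<open>T\<close>. No test rejects a subforest of a Leech tree: the parity classes of \<open>T\<close>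
  have sizes with sum \<open>18\<close> and product \<open>77\<close>, the number of odd distances; a path with 15 edges
  would be a Golomb ruler with 16 marks, whose length exceeds 153; and the distances in \<open>T\<close>
  between two components of \<open>F\<close> form pairwise disjoint blocks.
\<close>

section \<open>Paths in forests\<close>

text \<open>A path is a list of distinct vertices, so two paths cannot simply be concatenated.
  \<open>paths_meet\<close> cuts them at the first common vertex, and from it come the transitivity
  of \<open>joined\<close>, the uniqueness of paths in a forest and the parity of a triangle. Unique
  paths make the distances inside \<open>F\<close> agree with those of \<open>T\<close>, and since
  \<open>T\<close> takes each distance only once, a distance of \<open>T\<close> is internal to
  \<open>F\<close> exactly when its own pair is joined in \<open>F\<close>. This equivalence drives
  the forced weight as well as the block test. The ruler bound leaves little room. For 16 marks, the
  15 distinct gaps alone force only length 120, and the same estimate with differences over at most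
  two steps gives only 146. Three steps are the first choice that passes 153. The descent cannot get
  stuck before 17 edges, because a tree on 18 vertices has at least 17.\<close>

lemma path_singleton [simp]: "path G [x] \<longleftrightarrow> x \<in> verts G"
  by (auto simp: path_def)

lemma path_rev [simp]: "path G (rev p) \<longleftrightarrow> path G p"
  by (auto simp: path_def successively_rev insert_commute)

lemma path_split:
  assumes "path G (p @ w # q)"
  shows "path G (p @ [w])" "path G (w # q)"
  using assms by (auto simp: path_def successively_append_iff)

lemma path_glue:
  assumes "path G (p @ [w])" "path G (w # q)" "set p \<inter> set q = {}"
  shows "path G (p @ w # q)"
  using assms by (auto simp: path_def successively_append_iff)

lemma path_Cons_Cons:
  "path G (x # y # p) \<longleftrightarrow> x \<in> verts G \<and> x \<notin> set (y # p) \<and> {x, y} \<in> edges G \<and> path G (y # p)"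
  by (auto simp: path_def)

lemma path_ends_in_verts:
  assumes "path G p"
  shows "hd p \<in> verts G" "last p \<in> verts G"
  using assms by (auto simp: path_def)

lemma path_weight_single [simp]: "path_weight G [x] = 0"
  by (simp add: path_weight_def)

lemma path_weight_Cons_Cons [simp]:
  "path_weight G (x # y # p) = the (wt G {x, y}) + path_weight G (y # p)"
  by (simp add: path_weight_def)

lemma path_weight_glue:
  "path_weight G (p @ w # q) = path_weight G (p @ [w]) + path_weight G (w # q)"
proof (induction p)
  case (Cons a p)
  then show ?case by (cases p) simp_all
qed simp

lemma path_weight_rev [simp]: "path_weight G (rev p) = path_weight G p"
proof (induction p)
  case (Cons a p)
  show ?case
  proof (cases p)
    case (Cons b q)
    have "path_weight G (rev (a # p)) = path_weight G (rev q @ b # [a])" by (simp add: Cons)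
    also have "\<dots> = path_weight G (rev p) + path_weight G [b, a]"
      by (subst path_weight_glue) (simp add: Cons)
    finally show ?thesis using Cons.IH by (simp add: Cons insert_commute)
  qed simp
qed simp

lemma path_weight_pos:
  assumes "simple_wgraph G" "path G p" "hd p \<noteq> last p"
  shows "path_weight G p > 0"
proof -
  obtain x q where "p = x # q" using assms(2) by (cases p) (auto simp: path_def)
  then obtain y r where "p = x # y # r" using assms(3) by (cases q) auto
  then show ?thesis using assms(1,2) by (auto simp: path_Cons_Cons simple_wgraph_def)
qed

text \<open>The path \<open>q\<close> is followed until it first meets \<open>p\<close>.\<close>

lemma paths_meet:
  assumes "path G p" "path G q" "last p = last q"
  obtains a w b c d where "p = a @ w # b" "q = c @ w # d" "set c \<inter> set p = {}"
    "path G (a @ w # rev c)"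
proof -
  have "\<exists>x\<in>set q. x \<in> set p"
    using assms by (metis last_in_set path_def)
  from split_list_first_prop[OF this] obtain c w d
    where q: "q = c @ w # d" "w \<in> set p" "\<forall>y\<in>set c. y \<notin> set p" by blast
  obtain a b where p: "p = a @ w # b" using q(2) by (meson split_list)
  have "path G (rev (c @ [w]))" using path_split(1)[of G c w d] assms(2) q(1) by (metis path_rev)
  then have "path G (a @ w # rev c)"
    using path_split(1)[of G a w b] assms(1) p q(3) path_glue[of G a w "rev c"] by auto
  then show thesis using that p q by blast
qed

section \<open>Joinedness as an equivalence relation\<close>

lemma joined_refl: "x \<in> verts G \<Longrightarrow> joined G x x"
  unfolding joined_def by (rule exI[of _ "[x]"]) simp

lemma joined_sym: "joined G x y \<Longrightarrow> joined G y x"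
  unfolding joined_def by (metis hd_rev last_rev path_rev)

text \<open>The two paths may share vertices beyond \<open>y\<close>, so the first is left for the
  second at the meeting vertex, which need not be \<open>y\<close>.\<close>

lemma joined_trans:
  assumes "joined G x y" "joined G y z"
  shows "joined G x z"
proof -
  obtain p q where "path G p" "hd p = x" "last p = y" and "path G q" "hd q = z" "last q = y"
    using assms joined_sym unfolding joined_def by metis
  note pq = this
  obtain a w b c d where s: "p = a @ w # b" "q = c @ w # d" "path G (a @ w # rev c)"
    using paths_meet[OF pq(1,4)] pq(3,6) by metis
  have "hd (a @ w # rev c) = x" using pq(2) s(1) by (cases a) auto
  moreover have "last (a @ w # rev c) = z" using pq(5) s(2) by (cases c) auto
  ultimately show ?thesis unfolding joined_def using s(3) by blast
qed

lemma joined_verts: "joined G x y \<Longrightarrow> x \<in> verts G \<and> y \<in> verts G"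
  unfolding joined_def using path_ends_in_verts by blast

lemma joined_edge:
  assumes "simple_wgraph G" "{u, v} \<in> edges G"
  shows "joined G u v"
proof -
  have "path G [u, v]" using assms by (fastforce simp: path_def simple_wgraph_def doubleton_eq_iff)
  then show ?thesis unfolding joined_def by (intro exI[of _ "[u, v]"]) simp
qed

text \<open>Strip the common first vertex \<open>x\<close>. If the next vertices differ, both
  remainders still end at the same vertex, and following them up to their meeting point closes a
  cycle through \<open>x\<close>.\<close>

lemma forest_unique_path:
  assumes "forest G" "path G p" "path G q" "hd p = hd q" "last p = last q"
  shows "p = q"
  using assms(2-)
proof (induction p arbitrary: q)
  case Nil
  then show ?case by (simp add: path_def)
next
  case (Cons x p)
  obtain q' where q: "q = x # q'"
    using Cons.prems by (cases q) (auto simp: path_def)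
  show ?case
  proof (cases "p = [] \<or> q' = []")
    case True
    \<comment> \<open>If one path is the single vertex \<open>x\<close>, the other starts and ends
      at \<open>x\<close>, and distinctness leaves it no further vertex.\<close>
    have "p = []" if "q' = []" using that Cons.prems unfolding q path_def by (cases p rule: rev_cases) auto
    moreover have "q' = []" if "p = []" using that Cons.prems unfolding q path_def by (cases q' rule: rev_cases) auto
    ultimately show ?thesis using True q by blast
  next
    case False
    then have tl: "path G p" "path G q'" "last p = last q'" "x \<notin> set p" "x \<notin> set q'"
      "{x, hd p} \<in> edges G" "{x, hd q'} \<in> edges G" "x \<in> verts G"
      using Cons.prems unfolding q path_def by (auto simp: successively_Cons)
    have "hd p = hd q'"
    proof (rule ccontr)
      assume ne: "hd p \<noteq> hd q'"
      obtain a w b c d where s: "p = a @ w # b" "q' = c @ w # d" "path G (a @ w # rev c)"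
        using tl(1-3) by (metis paths_meet)
      let ?z = "x # a @ w # rev c"
      have "path G ?z"
        using s tl by (cases a) (auto simp: path_Cons_Cons)
      moreover have "last ?z = hd q'" using s by (cases c) auto
      \<comment> \<open>If \<open>a\<close> and \<open>c\<close> were both empty, both remainders
        would start at \<open>w\<close>, against \<open>ne\<close>.\<close>
      moreover have "length ?z \<ge> 3" using s ne by (cases a; cases c) auto
      ultimately have "cycle G ?z" using tl by (simp add: cycle_def insert_commute)
      then show False using assms(1) by (auto simp: forest_def)
    qed
    then have "p = q'" using Cons.IH tl by blast
    then show ?thesis using q by simp
  qed
qed

text \<open>The path between two given ends is unique up to reversal, which keeps its weight, so the
  \<open>LEAST\<close> ranges over a single value.\<close>

lemma wdist_path:
  assumes "forest G" "path G p"
  shows "wdist G {hd p, last p} = path_weight G p"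
proof -
  have "path_weight G q = path_weight G p"
    if q: "path G q" and ends: "{hd q, last q} = {hd p, last p}" for q
  proof -
    consider "hd q = hd p" "last q = last p" | "hd q = last p" "last q = hd p"
      using ends unfolding doubleton_eq_iff by blast
    then have "q = p \<or> q = rev p"
    proof cases
      case 1
      then show ?thesis using forest_unique_path[OF assms(1) q assms(2)] by simp
    next
      case 2
      then show ?thesis
        using forest_unique_path[OF assms(1) q, of "rev p"] assms(2)
        by (simp add: hd_rev last_rev)
    qed
    then show ?thesis by auto
  qed
  then show ?thesis
    unfolding wdist_def using assms(2) by (intro Least_equality) (blast, metis order_refl)
qed

lemma wdist_joined_path:
  assumes "forest G" "joined G x y"
  obtains p where "path G p" "hd p = x" "last p = y" "wdist G {x, y} = path_weight G p"
  using assms wdist_path unfolding joined_def by metis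

lemma wdist_edge:
  assumes "forest G" "{u, v} \<in> edges G"
  shows "wdist G {u, v} = the (wt G {u, v})"
proof -
  have "path G [u, v]"
    using assms by (fastforce simp: forest_def path_def simple_wgraph_def doubleton_eq_iff)
  from wdist_path[OF assms(1) this] show ?thesis by simp
qed

lemma wdist_pos:
  assumes "forest G" "joined G x y" "x \<noteq> y"
  shows "wdist G {x, y} > 0"
  using wdist_joined_path[OF assms(1,2)] path_weight_pos assms(1,3) forest_def by metis

text \<open>Each leg of the tripod spanned by \<open>x\<close>, \<open>y\<close> and \<open>z\<close> is counted twice.\<close>

lemma even_wdist_triangle:
  assumes G: "forest G" and j: "joined G x y" "joined G z y"
  shows "even (wdist G {x, y} + wdist G {z, y} + wdist G {x, z})"
proof -
  obtain p where p: "path G p" "hd p = x" "last p = y" "wdist G {x, y} = path_weight G p"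
    using wdist_joined_path[OF G j(1)] .
  obtain q where q: "path G q" "hd q = z" "last q = y" "wdist G {z, y} = path_weight G q"
    using wdist_joined_path[OF G j(2)] .
  obtain a w b c d where s: "p = a @ w # b" "q = c @ w # d" "path G (a @ w # rev c)"
    using p(1,3) q(1,3) by (metis paths_meet)
  have "hd (a @ w # rev c) = x" using p(2) s(1) by (cases a) auto
  moreover have "last (a @ w # rev c) = z" using q(2) s(2) by (cases c) auto
  ultimately have xz: "wdist G {x, z} = path_weight G (a @ w # rev c)"
    using wdist_path[OF G s(3)] by simp
  \<comment> \<open>From the meeting vertex on, both paths are the unique path to
    \<open>y\<close>.\<close>
  have "w # b = w # d"
    using forest_unique_path[OF G path_split(2) path_split(2), of a w b c w d] p q s by auto
  then have "wdist G {x, y} = path_weight G (a @ [w]) + path_weight G (w # b)"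
    "wdist G {z, y} = path_weight G (c @ [w]) + path_weight G (w # b)"
    using p(4) q(4) s path_weight_glue by metis+
  moreover have "wdist G {x, z} = path_weight G (a @ [w]) + path_weight G (c @ [w])"
    using xz path_weight_glue[of G a w "rev c"] path_weight_rev[of G "c @ [w]"] by simp
  ultimately have "wdist G {x, y} + wdist G {z, y} + wdist G {x, z} =
      2 * (path_weight G (a @ [w]) + path_weight G (c @ [w]) + path_weight G (w # b))" by simp
  then show ?thesis by simp
qed

text \<open>Root the tree at \<open>r\<close> and send every other vertex \<open>v\<close> to the
  edge from its parent \<open>u v\<close>, the last vertex but one on the path from
  \<open>r\<close>. This map is injective.\<close>

lemma tree_edges_ge:
  assumes "tree G"
  shows "card (verts G) \<le> Suc (card (edges G))"
proof -
  have G: "forest G" and s: "simple_wgraph G" and fin: "finite (verts G)"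
    using assms by (auto simp: tree_def forest_def simple_wgraph_def)
  obtain r where r: "r \<in> verts G" using assms by (auto simp: tree_def)
  have "edges G \<subseteq> Pow (verts G)" using s by (auto simp: simple_wgraph_def)
  then have finE: "finite (edges G)" using fin by (meson finite_Pow_iff finite_subset)
  have "\<forall>v\<in>verts G - {r}. \<exists>p. path G p \<and> hd p = r \<and> last p = v \<and> p \<noteq> [r]"
    using assms r by (fastforce simp: tree_def joined_def)
  then obtain P where P: "\<And>v. v \<in> verts G - {r} \<Longrightarrow> path G (P v) \<and> hd (P v) = r \<and> last (P v) = v"
    by metis
  define u where "u v = last (butlast (P v))" for v
  have bl: "P v = butlast (P v) @ [v]" "butlast (P v) \<noteq> []" if "v \<in> verts G - {r}" for v
  proof -
    have "P v \<noteq> []" using P[OF that] by (simp add: path_def)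
    then show "P v = butlast (P v) @ [v]" using P[OF that] append_butlast_last_id by metis
    then show "butlast (P v) \<noteq> []" using P[OF that] that by (metis DiffE append_Nil list.sel(1) singletonI)
  qed
  have bp: "path G (butlast (P v))" "hd (butlast (P v)) = r" "{u v, v} \<in> edges G" "u v \<noteq> v"
    if v: "v \<in> verts G - {r}" for v
  proof -
    obtain q where q: "P v = q @ [v]" "q \<noteq> []" using bl[OF v] by blast
    have "path G (q @ [v])" "hd (q @ [v]) = r" using P[OF v] q by auto
    then show "path G (butlast (P v))" "hd (butlast (P v)) = r" "{u v, v} \<in> edges G" "u v \<noteq> v"
      using q unfolding u_def by (auto simp: path_def successively_append_iff)
  qed
  have "inj_on (\<lambda>v. {u v, v}) (verts G - {r})"
  proof (rule inj_onI)
    fix v v' assume v: "v \<in> verts G - {r}" and v': "v' \<in> verts G - {r}" and e: "{u v, v} = {u v', v'}"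
    show "v = v'"
    proof (rule ccontr)
      assume "v \<noteq> v'"
      \<comment> \<open>Two vertices with the same edge would be parents of each other, and each of
        their paths from \<open>r\<close> would be the other one without its last vertex.\<close>
      then have "u v = v'" "u v' = v" using e by (auto simp: doubleton_eq_iff)
      then have "butlast (P v) = P v'" "butlast (P v') = P v"
        using forest_unique_path[OF G bp(1)[OF v], of "P v'"] P[OF v'] bp(2)[OF v]
          forest_unique_path[OF G bp(1)[OF v'], of "P v"] P[OF v] bp(2)[OF v'] unfolding u_def by auto
      then have "length (P v) = length (P v) - 1 - 1" by (metis length_butlast)
      then show False using P[OF v] by (cases "P v") (auto simp: path_def)
    qed
  qed
  moreover have "(\<lambda>v. {u v, v}) ` (verts G - {r}) \<subseteq> edges G" using bp(3) by blast
  ultimately have "card (verts G - {r}) \<le> card (edges G)" using finE card_inj_on_le by blast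
  then show ?thesis using r fin by simp
qed

section \<open>Components\<close>

lemma component_mem:
  assumes "K \<in> components G" "x \<in> K"
  shows "y \<in> K \<longleftrightarrow> joined G x y"
proof -
  obtain r where K: "K = {y \<in> verts G. joined G r y}"
    using assms(1) by (auto simp: components_def)
  then have "joined G r x" using assms(2) by simp
  then have "joined G r y \<longleftrightarrow> joined G x y" using joined_trans joined_sym by metis
  then show ?thesis using K joined_verts by fast
qed

lemma component_subset: "K \<in> components G \<Longrightarrow> K \<subseteq> verts G"
  by (auto simp: components_def)

lemma component_nonempty: "K \<in> components G \<Longrightarrow> K \<noteq> {}"
  by (auto simp: components_def intro: joined_refl)

lemma in_some_component: "x \<in> verts G \<Longrightarrow> \<exists>K\<in>components G. x \<in> K"
  by (auto simp: components_def intro: joined_refl)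

lemma components_eqI:
  assumes "K \<in> components G" "K' \<in> components G" "x \<in> K" "x \<in> K'"
  shows "K = K'"
  using component_mem[OF assms(1,3)] component_mem[OF assms(2,4)] by blast

lemma internal_pairs_iff: "{x, y} \<in> internal_pairs G \<longleftrightarrow> x \<noteq> y \<and> joined G x y"
proof
  assume "{x, y} \<in> internal_pairs G"
  then obtain a b K where K: "K \<in> components G" and ab: "{x, y} = {a, b}" "a \<in> K" "b \<in> K" "a \<noteq> b"
    unfolding internal_pairs_def by blast
  then have "x \<in> K" "y \<in> K" "x \<noteq> y" by (auto simp: doubleton_eq_iff)
  then show "x \<noteq> y \<and> joined G x y" using component_mem[OF K] by blast
next
  assume "x \<noteq> y \<and> joined G x y"
  moreover from this obtain K where "K \<in> components G" "x \<in> K"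
    using in_some_component[of x G] joined_verts by metis
  ultimately show "{x, y} \<in> internal_pairs G"
    unfolding internal_pairs_def using component_mem[of K G x y] by blast
qed

lemma internal_pairs_cases:
  assumes "e \<in> internal_pairs G"
  obtains x y where "e = {x, y}" "x \<noteq> y" "joined G x y"
proof -
  obtain x y where "e = {x, y}" using assms unfolding internal_pairs_def by blast
  then show thesis using that assms internal_pairs_iff by metis
qed

lemma finite_components: "finite (verts G) \<Longrightarrow> finite (components G)"
  by (simp add: components_def)

text \<open>With a colour class of the whole tree as \<open>A\<close>, this turns the sums over
  components in the parity test into global counts.\<close>

lemma sum_card_components:
  assumes "finite (verts G)"
  shows "(\<Sum>K\<in>components G. card (K \<inter> A)) = card (verts G \<inter> A)"
proof -
  have "verts G \<inter> A = (\<Union>K\<in>components G. K \<inter> A)"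
    using in_some_component component_subset by fast
  also have "card \<dots> = (\<Sum>K\<in>components G. card (K \<inter> A))"
    using assms finite_components[OF assms] component_subset[of _ G] components_eqI[of _ G]
    by (intro card_UN_disjoint) (blast intro: finite_subset)+
  finally show ?thesis ..
qed

section \<open>Subgraphs and isomorphisms\<close>

text \<open>Spanning, because the isolated vertices of a state are components of their own, which
  the parity and block tests take into account.\<close>

definition subgraph :: "'a wgraph \<Rightarrow> 'a wgraph \<Rightarrow> bool" where
  "subgraph F T \<longleftrightarrow> verts F = verts T \<and> wt F \<subseteq>\<^sub>m wt T"

lemma subgraph_edges: "subgraph F T \<Longrightarrow> edges F \<subseteq> edges T"
  by (auto simp: subgraph_def edges_def map_le_implies_dom_le)

lemma subgraph_wt: "subgraph F T \<Longrightarrow> e \<in> edges F \<Longrightarrow> wt T e = wt F e"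
  by (simp add: subgraph_def edges_def map_le_def)

lemma subgraph_path:
  assumes "subgraph F T" "path F p"
  shows "path T p"
proof -
  have "successively (\<lambda>u v. {u, v} \<in> edges T) p"
    using assms(2) subgraph_edges[OF assms(1)] unfolding path_def
    by (blast intro: successively_mono)
  then show ?thesis using assms by (simp add: path_def subgraph_def)
qed

lemma subgraph_path_weight:
  assumes "subgraph F T" "path F p"
  shows "path_weight T p = path_weight F p"
  using assms(2)
proof (induction p)
  case (Cons a p)
  then show ?case using subgraph_wt[OF assms(1)] by (cases p) (auto simp: path_Cons_Cons)
qed (simp add: path_weight_def)

lemma subgraph_forest:
  assumes "subgraph F T" "forest T"
  shows "forest F"
proof -
  have "simple_wgraph F"
    using assms subgraph_edges[OF assms(1)] subgraph_wt[OF assms(1)]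
    by (force simp: simple_wgraph_def forest_def subgraph_def)
  then show ?thesis
    using assms subgraph_edges[OF assms(1)] subgraph_path[OF assms(1)]
    by (auto simp: forest_def cycle_def)
qed

lemma subgraph_wdist:
  assumes "subgraph F T" "forest T" "joined F x y"
  shows "wdist T {x, y} = wdist F {x, y}"
proof -
  obtain p where p: "path F p" "hd p = x" "last p = y" using assms(3) by (auto simp: joined_def)
  then show ?thesis
    using wdist_path[OF assms(2) subgraph_path[OF assms(1) p(1)]]
      wdist_path[OF subgraph_forest[OF assms(1,2)] p(1)] subgraph_path_weight[OF assms(1) p(1)]
    by simp
qed

text \<open>A path of \<open>F\<close> between the ends of the edge is also the path of
  \<open>T\<close> between them, hence the edge itself. So every edge of \<open>T\<close> missing
  from \<open>F\<close> runs between different components of \<open>F\<close>.\<close>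

lemma subgraph_edge_joined:
  assumes sub: "subgraph F T" and T: "forest T" and e: "{u, v} \<in> edges T" and j: "joined F u v"
  shows "{u, v} \<in> edges F"
proof -
  obtain p where p: "path F p" "hd p = u" "last p = v" using j by (auto simp: joined_def)
  have "path T [u, v]"
    using T e by (fastforce simp: forest_def path_def simple_wgraph_def doubleton_eq_iff)
  then have "p = [u, v]"
    using forest_unique_path[OF T subgraph_path[OF sub p(1)], of "[u, v]"] p by simp
  then show ?thesis using p(1) by (simp add: path_Cons_Cons)
qed

section \<open>Isomorphisms and transport of Leech trees\<close>

lemma isomorphism_path:
  assumes "isomorphism f G H" "set p \<subseteq> verts G"
  shows "path H (map f p) \<longleftrightarrow> path G p"
proof -
  have bij: "bij_betw f (verts G) (verts H)" using assms by (simp add: isomorphism_def)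
  then have "inj_on f (set p)" "f ` set p \<subseteq> verts H"
    using assms(2) by (auto simp: bij_betw_def inj_on_subset)
  moreover have "successively (\<lambda>u v. {f u, f v} \<in> edges H) p \<longleftrightarrow> successively (\<lambda>u v. {u, v} \<in> edges G) p"
    using assms by (intro successively_cong) (auto simp: isomorphism_def)
  ultimately show ?thesis
    using assms(2) by (auto simp: path_def distinct_map successively_map)
qed

lemma isomorphism_path_weight:
  assumes "isomorphism f G H" "path G p"
  shows "path_weight H (map f p) = path_weight G p"
  using assms(2)
proof (induction p)
  case (Cons a p)
  show ?case
  proof (cases p)
    case (Cons b q)
    then have "{a, b} \<in> edges G" "a \<in> verts G" "b \<in> verts G"
      using Cons.prems by (auto simp: path_def)
    then have "the (wt H {f a, f b}) = the (wt G {a, b})"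
      using assms(1) by (simp add: isomorphism_def)
    then show ?thesis using Cons.IH Cons.prems Cons by (simp add: path_Cons_Cons)
  qed simp
qed (simp add: path_weight_def)

lemma isomorphism_path_lift:
  assumes "isomorphism f G H" "path H q"
  obtains p where "q = map f p" "path G p"
proof -
  have "f ` verts G = verts H" using assms(1) by (simp add: isomorphism_def bij_betw_def)
  then have "q \<in> map f ` lists (verts G)"
    using assms(2) by (auto simp: path_def lists_image[symmetric])
  then obtain p where p: "q = map f p" "set p \<subseteq> verts G" by auto
  then show thesis using that[OF p(1)] isomorphism_path[OF assms(1) p(2)] assms(2) by simp
qed

text \<open>The predicates under the two \<open>LEAST\<close> operators agree for every
  \<open>d\<close>: paths correspond under \<open>map f\<close>, and injectivity recovers
  \<open>e\<close> from its image.\<close>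

lemma isomorphism_wdist:
  assumes iso: "isomorphism f G H" and e: "e \<subseteq> verts G"
  shows "wdist H (f ` e) = wdist G e"
proof -
  have inj: "inj_on f (verts G)" using iso by (simp add: isomorphism_def bij_betw_def)
  have "(\<exists>p. path H p \<and> {hd p, last p} = f ` e \<and> path_weight H p = d) \<longleftrightarrow>
        (\<exists>p. path G p \<and> {hd p, last p} = e \<and> path_weight G p = d)" for d
  proof -
    have ends: "{hd (map f p), last (map f p)} = f ` e \<longleftrightarrow> {hd p, last p} = e" if "path G p" for p
    proof -
      have "{hd (map f p), last (map f p)} = f ` {hd p, last p}"
        using that by (simp add: path_def hd_map last_map)
      then show ?thesis
        using inj_on_image_eq_iff[OF inj _ e, of "{hd p, last p}"] path_ends_in_verts[OF that] by simp
    qed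
    show ?thesis
    proof
      assume "\<exists>p. path H p \<and> {hd p, last p} = f ` e \<and> path_weight H p = d"
      then obtain q where q: "path H q" "{hd q, last q} = f ` e" "path_weight H q = d" by blast
      from isomorphism_path_lift[OF iso q(1)] obtain p where p: "q = map f p" "path G p" .
      have "{hd p, last p} = e" "path_weight G p = d"
        using q(2,3) ends[OF p(2)] isomorphism_path_weight[OF iso p(2)] unfolding p(1) by auto
      then show "\<exists>p. path G p \<and> {hd p, last p} = e \<and> path_weight G p = d"
        using p(2) by blast
    next
      assume "\<exists>p. path G p \<and> {hd p, last p} = e \<and> path_weight G p = d"
      then obtain p where p: "path G p" "{hd p, last p} = e" "path_weight G p = d" by blast
      have "path H (map f p)" using p(1) isomorphism_path[OF iso, of p] by (simp add: path_def)
      moreover have "{hd (map f p), last (map f p)} = f ` e" using ends[OF p(1)] p(2) by blast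
      moreover have "path_weight H (map f p) = d"
        using isomorphism_path_weight[OF iso p(1)] p(3) by simp
      ultimately show "\<exists>p. path H p \<and> {hd p, last p} = f ` e \<and> path_weight H p = d"
        by blast
    qed
  qed
  then show ?thesis unfolding wdist_def by presburger
qed

lemma isomorphism_cycle:
  assumes iso: "isomorphism f G H" and c: "cycle H q"
  shows "\<exists>p. cycle G p"
proof -
  obtain p where p: "q = map f p" "path G p"
    using isomorphism_path_lift[OF iso] c by (metis cycle_def)
  then have "{last p, hd p} \<in> edges G"
    using c iso path_ends_in_verts[OF p(2)]
    by (simp add: cycle_def path_def hd_map last_map isomorphism_def)
  then show ?thesis using p c by (auto simp: cycle_def)
qed

text \<open>An isomorphism only controls the sets \<open>{u, v}\<close> of vertices; simplicity of
  \<open>H\<close> excludes any other set from the domain of its weight map.\<close>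

lemma isomorphism_tree:
  assumes iso: "isomorphism f G H" and H: "simple_wgraph H" and G: "tree G"
  shows "tree H"
proof -
  have im: "verts H = f ` verts G" using iso by (simp add: isomorphism_def bij_betw_def)
  have "joined H (f x) (f y)" if "x \<in> verts G" "y \<in> verts G" for x y
  proof -
    have "joined G x y" using G that by (simp add: tree_def)
    then obtain p where p: "path G p" "hd p = x" "last p = y" by (auto simp: joined_def)
    then have "path H (map f p)" "hd (map f p) = f x" "last (map f p) = f y"
      using isomorphism_path[OF iso, of p] by (auto simp: path_def hd_map last_map)
    then show ?thesis unfolding joined_def by blast
  qed
  then show ?thesis
    using G H im isomorphism_cycle[OF iso] by (auto simp: tree_def forest_def)
qed

lemma isomorphism_leech_tree:
  assumes iso: "isomorphism f G H" and H: "simple_wgraph H" and G: "leech_tree n G"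
  shows "leech_tree n H"
proof -
  have bij: "bij_betw f (verts G) (verts H)" using iso by (simp add: isomorphism_def)
  let ?P = "\<lambda>G. {e. e \<subseteq> verts G \<and> card e = 2}"
  have P: "bij_betw (image f) (?P G) (?P H)"
    unfolding bij_betw_def
  proof
    show "inj_on (image f) (?P G)"
      using inj_on_image_eq_iff[OF bij_betw_imp_inj_on[OF bij]] by (intro inj_onI) blast
    have card: "card (f ` d) = card d" if "d \<subseteq> verts G" for d
      using that bij by (meson bij_betw_imp_inj_on card_image inj_on_subset)
    have im: "f ` verts G = verts H" using bij by (rule bij_betw_imp_surj_on)
    show "image f ` ?P G = ?P H"
    proof (intro equalityI subsetI)
      fix e assume "e \<in> image f ` ?P G"
      then obtain d where "d \<subseteq> verts G" "card d = 2" "e = f ` d" by blast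
      then show "e \<in> ?P H" using card im by (simp add: image_mono flip: im)
    next
      fix e assume e: "e \<in> ?P H"
      then have "e \<subseteq> f ` verts G" using im by simp
      then obtain d where d: "d \<subseteq> verts G" "e = f ` d" by (meson subset_imageE)
      then have "d \<in> ?P G" using e card by simp
      then show "e \<in> image f ` ?P G" using d(2) by (rule rev_image_eqI)
    qed
  qed
  have "bij_betw (\<lambda>e. wdist H (f ` e)) (?P G) {1..n choose 2}"
    using G isomorphism_wdist[OF iso]
    by (subst bij_betw_cong[where g = "wdist G"]) (auto simp: leech_tree_def)
  then have "bij_betw (wdist H) (?P H) {1..n choose 2}"
    using bij_betw_comp_iff[OF P, of "wdist H"] by (simp add: o_def)
  moreover have "card (verts H) = n" using G bij bij_betw_same_card by (metis leech_tree_def)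
  ultimately show ?thesis using isomorphism_tree[OF iso H] G by (simp add: leech_tree_def)
qed

text \<open>Outside the image of \<open>f\<close> the inverse is unspecified and might carry a
  foreign set onto an edge of \<open>G\<close>; the guard prevents this.\<close>

definition relabel :: "('a \<Rightarrow> 'b) \<Rightarrow> 'a wgraph \<Rightarrow> 'b wgraph" where
  "relabel f G = \<lparr>verts = f ` verts G,
     wt = (\<lambda>e. if e \<subseteq> f ` verts G then wt G (inv_into (verts G) f ` e) else None)\<rparr>"

lemma wt_relabel:
  assumes "inj_on f (verts G)" "u \<in> verts G" "v \<in> verts G"
  shows "wt (relabel f G) {f u, f v} = wt G {u, v}"
  using assms by (simp add: relabel_def)

lemma isomorphism_relabel:
  assumes "inj_on f (verts G)"
  shows "isomorphism f G (relabel f G)"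
  using assms wt_relabel[OF assms]
  by (auto simp: isomorphism_def bij_betw_def edges_def domIff) (auto simp: relabel_def)

lemma simple_relabel:
  assumes inj: "inj_on f (verts G)" and G: "simple_wgraph G"
  shows "simple_wgraph (relabel f G)"
proof -
  have "\<exists>u\<in>verts (relabel f G). \<exists>v\<in>verts (relabel f G). u \<noteq> v \<and> e = {u, v} \<and> the (wt (relabel f G) e) > 0"
    if e: "e \<in> edges (relabel f G)" for e
  proof -
    let ?d = "inv_into (verts G) f ` e"
    have sub: "e \<subseteq> f ` verts G" and w: "wt (relabel f G) e = wt G ?d" "?d \<in> edges G"
      using e by (auto simp: edges_def relabel_def domIff split: if_splits)
    have "\<exists>u\<in>verts G. \<exists>v\<in>verts G. u \<noteq> v \<and> ?d = {u, v}"
      using G w(2) by (simp add: simple_wgraph_def)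
    then obtain u v where uv: "u \<in> verts G" "v \<in> verts G" "u \<noteq> v" "?d = {u, v}" by blast
    have "e = f ` ?d" using sub by (simp add: image_inv_into_cancel)
    then have "e = {f u, f v}" using uv by simp
    moreover have "f u \<noteq> f v" using uv inj by (meson inj_onD)
    moreover have "the (wt (relabel f G) e) > 0" using G w by (simp add: simple_wgraph_def)
    ultimately show ?thesis using uv by (auto simp: relabel_def)
  qed
  moreover have "finite (verts (relabel f G))"
    using G by (simp add: simple_wgraph_def relabel_def)
  ultimately show ?thesis unfolding simple_wgraph_def by metis
qed

text \<open>Since \<open>H\<close> spans \<open>T\<close>, the map \<open>f\<close> moves all of
  \<open>T\<close>, and the image of \<open>H\<close> inside it is \<open>F\<close>. This serves
  both for the root, where \<open>H\<close> consists of the three lightest edges, and for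
  automorphisms of a state, where \<open>H\<close> and \<open>F\<close> coincide.\<close>

lemma leech_tree_relabel:
  assumes T: "leech_tree n T" and sub: "subgraph H T" and iso: "isomorphism f H F"
    and F: "simple_wgraph F"
  shows "leech_tree n (relabel f T)" "subgraph F (relabel f T)" "isomorphism f T (relabel f T)"
proof -
  have inj: "inj_on f (verts T)" and im: "f ` verts T = verts F" and v: "verts H = verts T"
    using iso sub by (auto simp: isomorphism_def bij_betw_def subgraph_def)
  have s: "simple_wgraph T" using T by (simp add: leech_tree_def tree_def forest_def)
  show i: "isomorphism f T (relabel f T)" using isomorphism_relabel[OF inj] .
  show "leech_tree n (relabel f T)"
    using isomorphism_leech_tree[OF i simple_relabel[OF inj s] T] .
  have "wt (relabel f T) e = wt F e" if e: "e \<in> edges F" for e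
  proof -
    have "\<exists>a\<in>f ` verts T. \<exists>b\<in>f ` verts T. a \<noteq> b \<and> e = {a, b}"
      using F e unfolding im by (simp add: simple_wgraph_def)
    then obtain u v' where uv: "u \<in> verts T" "v' \<in> verts T" "e = {f u, f v'}" by blast
    then have "{u, v'} \<in> edges H" "the (wt F e) = the (wt H {u, v'})"
      using iso e v by (auto simp: isomorphism_def)
    then show ?thesis
      using wt_relabel[OF inj uv(1,2)] subgraph_wt[OF sub, of "{u, v'}"] e uv(3)
      by (auto simp: edges_def)
  qed
  then show "subgraph F (relabel f T)"
    using im by (simp add: subgraph_def map_le_def edges_def) (simp add: relabel_def)
qed

section \<open>Leech trees\<close>

lemma leech_tree_forest: "leech_tree n T \<Longrightarrow> forest T"
  by (simp add: leech_tree_def tree_def)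

lemma leech_tree_joined: "leech_tree n T \<Longrightarrow> x \<in> verts T \<Longrightarrow> y \<in> verts T \<Longrightarrow> joined T x y"
  by (simp add: leech_tree_def tree_def)

lemma leech_tree_wdist_inj:
  assumes T: "leech_tree n T" and v: "x \<in> verts T" "y \<in> verts T" "u \<in> verts T" "v \<in> verts T"
    and ne: "x \<noteq> y" "u \<noteq> v" and eq: "wdist T {x, y} = wdist T {u, v}"
  shows "{x, y} = {u, v}"
proof -
  have "inj_on (wdist T) {e. e \<subseteq> verts T \<and> card e = 2}"
    using T by (simp add: leech_tree_def bij_betw_def)
  from inj_onD[OF this eq] show ?thesis using v ne by simp
qed

lemma leech_tree_wdist_range:
  assumes "leech_tree n T" "x \<in> verts T" "y \<in> verts T" "x \<noteq> y"
  shows "wdist T {x, y} \<in> {1..n choose 2}"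
proof -
  have "wdist T ` {e. e \<subseteq> verts T \<and> card e = 2} = {1..n choose 2}"
    using assms(1) by (simp add: leech_tree_def bij_betw_def)
  moreover have "{x, y} \<in> {e. e \<subseteq> verts T \<and> card e = 2}" using assms by simp
  ultimately show ?thesis by blast
qed

lemma leech_tree_wdist_surj:
  assumes "leech_tree n T" "d \<in> {1..n choose 2}"
  obtains x y where "x \<in> verts T" "y \<in> verts T" "x \<noteq> y" "wdist T {x, y} = d"
proof -
  have "wdist T ` {e. e \<subseteq> verts T \<and> card e = 2} = {1..n choose 2}"
    using assms(1) by (simp add: leech_tree_def bij_betw_def)
  then have "d \<in> wdist T ` {e. e \<subseteq> verts T \<and> card e = 2}" using assms(2) by simp
  then obtain e where e: "e \<subseteq> verts T" "card e = 2" "wdist T e = d" by blast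
  then obtain x y where "e = {x, y}" "x \<noteq> y" by (meson card_2_iff)
  then show thesis using that e by blast
qed

lemma choose_18_2: "18 choose 2 = (153 :: nat)"
  by (simp add: choose_two)

text \<open>Locates, on a path of \<open>T\<close> that is not a path of \<open>F\<close>, an edge
  outside \<open>F\<close>.\<close>

lemma not_successively_split:
  "\<not> successively P xs \<Longrightarrow> \<exists>ys u v zs. xs = ys @ u # v # zs \<and> \<not> P u v"
proof (induction xs)
  case (Cons a xs)
  show ?case
  proof (cases xs)
    case Nil
    then show ?thesis using Cons.prems by simp
  next
    case (Cons b cs)
    show ?thesis
    proof (cases "P a b")
      case True
      then have "\<not> successively P xs" using Cons.prems Cons by simp
      then obtain ys u v zs where "xs = ys @ u # v # zs" "\<not> P u v" using Cons.IH by blast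
      then have "a # xs = (a # ys) @ u # v # zs \<and> \<not> P u v" by simp
      then show ?thesis by blast
    next
      case False
      then have "a # xs = [] @ a # b # cs \<and> \<not> P a b" using Cons by simp
      then show ?thesis by blast
    qed
  qed
qed simp

section \<open>Subforests of a Leech tree\<close>

context
  fixes n :: nat and T F :: "nat wgraph"
  assumes leech: "leech_tree n T" and sub: "subgraph F T"
begin

lemma verts_eq: "verts F = verts T"
  using sub by (simp add: subgraph_def)

lemma finite_verts: "finite (verts T)"
  using leech by (simp add: leech_tree_def tree_def forest_def simple_wgraph_def)

lemma simple_subgraph: "simple_wgraph F"
  using subgraph_forest[OF sub leech_tree_forest[OF leech]] by (simp add: forest_def)

lemma wdist_eq: "joined F x y \<Longrightarrow> wdist F {x, y} = wdist T {x, y}"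
  using subgraph_wdist[OF sub leech_tree_forest[OF leech]] by simp

text \<open>An internal distance of \<open>F\<close> is attained in \<open>T\<close> by one pair
  only, so that pair must be \<open>{x, y}\<close>. The values missing from \<open>F\<close> are
  thus those of pairs in different components.\<close>

lemma internal_dists_mem:
  assumes "x \<in> verts T" "y \<in> verts T" "x \<noteq> y"
  shows "wdist T {x, y} \<in> internal_dists F \<longleftrightarrow> joined F x y"
proof
  assume "wdist T {x, y} \<in> internal_dists F"
  then obtain e where e: "e \<in> internal_pairs F" "wdist T {x, y} = wdist F e"
    by (auto simp: internal_dists_def)
  obtain u v where uv: "e = {u, v}" "u \<noteq> v" "joined F u v" using internal_pairs_cases[OF e(1)] .
  then have "{x, y} = {u, v}"
    using leech_tree_wdist_inj[OF leech assms(1,2)] assms(3) e(2) wdist_eq joined_verts[OF uv(3)]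
    unfolding verts_eq by simp
  then show "joined F x y" using uv joined_sym by (metis doubleton_eq_iff)
next
  assume j: "joined F x y"
  then have "{x, y} \<in> internal_pairs F" using assms(3) by (simp add: internal_pairs_iff)
  then have "wdist F {x, y} \<in> internal_dists F" by (simp add: internal_dists_def)
  then show "wdist T {x, y} \<in> internal_dists F" using wdist_eq[OF j] by simp
qed

lemma inj_on_internal_pairs: "inj_on (wdist F) (internal_pairs F)"
proof (rule inj_onI)
  fix e e' assume e: "e \<in> internal_pairs F" "e' \<in> internal_pairs F" "wdist F e = wdist F e'"
  obtain x y where xy: "e = {x, y}" "x \<noteq> y" "joined F x y" using internal_pairs_cases[OF e(1)] .
  obtain u v where uv: "e' = {u, v}" "u \<noteq> v" "joined F u v" using internal_pairs_cases[OF e(2)] .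
  show "e = e'"
    using leech_tree_wdist_inj[OF leech _ _ _ _ xy(2) uv(2)] e(3) xy uv wdist_eq[OF xy(3)]
      wdist_eq[OF uv(3)] joined_verts[OF xy(3)] joined_verts[OF uv(3)] unfolding verts_eq by simp
qed

lemma internal_dists_range: "internal_dists F \<subseteq> {1..n choose 2}"
proof
  fix d assume "d \<in> internal_dists F"
  then obtain e where e: "e \<in> internal_pairs F" "d = wdist F e" by (auto simp: internal_dists_def)
  obtain x y where xy: "e = {x, y}" "x \<noteq> y" "joined F x y" using internal_pairs_cases[OF e(1)] .
  show "d \<in> {1..n choose 2}"
    using leech_tree_wdist_range[OF leech _ _ xy(2)] e(2) xy(1) wdist_eq[OF xy(3)]
      joined_verts[OF xy(3)] unfolding verts_eq by simp
qed

text \<open>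
  A path of length \<open>forced_weight F\<close> in \<open>T\<close> must leave \<open>F\<close>, and each edge outside \<open>F\<close> already
  weighs at least \<open>forced_weight F\<close>, since its weight is not an internal distance of \<open>F\<close>.
\<close>

lemma forced_edge:
  assumes ne: "edges F \<noteq> edges T"
  obtains u v where "u \<in> verts T" "v \<in> verts T" "\<not> joined F u v"
    "wt T {u, v} = Some (forced_weight F)"
proof -
  have T: "forest T" and sT: "simple_wgraph T"
    using leech_tree_forest[OF leech] by (auto simp: forest_def)
  let ?m = "forced_weight F"
  have new: "u \<in> verts T \<and> v \<in> verts T \<and> u \<noteq> v \<and> \<not> joined F u v \<and> 0 < wdist T {u, v} \<and> ?m \<le> wdist T {u, v}"
    if "{u, v} \<in> edges T" "{u, v} \<notin> edges F" for u v
  proof -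
    have j: "\<not> joined F u v" using subgraph_edge_joined[OF sub T that(1)] that(2) by blast
    have v: "u \<in> verts T" "v \<in> verts T" using joined_verts[OF joined_edge[OF sT that(1)]] by auto
    then have "u \<noteq> v" using j joined_refl verts_eq by metis
    moreover have "0 < wdist T {u, v}" using wdist_pos[OF T] leech_tree_joined[OF leech v] \<open>u \<noteq> v\<close> .
    moreover have "wdist T {u, v} \<notin> internal_dists F" using internal_dists_mem[OF v] j \<open>u \<noteq> v\<close> by simp
    ultimately show ?thesis using j v unfolding forced_weight_def by (simp add: Least_le)
  qed
  obtain e where e: "e \<in> edges T" "e \<notin> edges F" using ne subgraph_edges[OF sub] by blast
  then have "\<exists>a\<in>verts T. \<exists>b\<in>verts T. a \<noteq> b \<and> e = {a, b}" using sT by (simp add: simple_wgraph_def)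
  then obtain a b where ab: "e = {a, b}" by blast
  note nab = new[OF e[unfolded ab]]
  let ?P = "\<lambda>m. 0 < m \<and> m \<notin> internal_dists F"
  \<comment> \<open>An edge outside \<open>F\<close> supplies a missing value in the range of
    \<open>T\<close>; the least missing value lies below it and is therefore a distance of
    \<open>T\<close> too.\<close>
  have "?P (wdist T {a, b})" using internal_dists_mem[of a b] nab by simp
  then have m: "?P ?m" unfolding forced_weight_def by (rule LeastI[of ?P])
  have "?m \<in> {1..n choose 2}"
    using m nab leech_tree_wdist_range[OF leech, of a b] by auto
  then obtain x y where xy: "x \<in> verts T" "y \<in> verts T" "x \<noteq> y" "wdist T {x, y} = ?m"
    using leech_tree_wdist_surj[OF leech] by blast
  then have nj: "\<not> joined F x y" using internal_dists_mem[of x y] m by simp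
  obtain p where p: "path T p" "hd p = x" "last p = y" "wdist T {x, y} = path_weight T p"
    using wdist_joined_path[OF T leech_tree_joined[OF leech xy(1,2)]] .
  have "\<not> path F p" using nj p unfolding joined_def by blast
  then have "\<not> successively (\<lambda>u v. {u, v} \<in> edges F) p"
    using p(1) by (auto simp: path_def verts_eq)
  then obtain p1 u v p2 where s: "p = p1 @ u # v # p2" "{u, v} \<notin> edges F"
    using not_successively_split by (metis (no_types, lifting))
  have uvT: "{u, v} \<in> edges T"
    using path_split(2)[OF p(1)[unfolded s(1)]] by (simp add: path_Cons_Cons)
  note nuv = new[OF uvT s(2)]
  have "the (wt T {u, v}) \<le> path_weight T p"
    unfolding s(1) path_weight_glue[of T p1 u "v # p2"] by simp
  then have "the (wt T {u, v}) = ?m"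
    using nuv p(4) xy(4) wdist_edge[OF T uvT] by simp
  then have "wt T {u, v} = Some ?m" using uvT by (auto simp: edges_def)
  then show thesis using that nuv by blast
qed

lemma path_in_component:
  assumes "K \<in> components F" "path F p" "hd p \<in> K"
  shows "set p \<subseteq> K"
proof
  fix w assume "w \<in> set p"
  then obtain a b where p: "p = a @ w # b" by (meson split_list)
  have "path F (a @ [w])" using path_split(1)[of F a w b] assms(2) p by simp
  moreover have "hd (a @ [w]) = hd p" using p by (cases a) auto
  ultimately have "joined F (hd p) w" unfolding joined_def by (metis last_snoc)
  then show "w \<in> K" using component_mem[OF assms(1,3)] by blast
qed

text \<open>A shortest path from \<open>K\<close> to \<open>K'\<close> is the only connection between them.\<close>

lemma component_gates:
  assumes K: "K \<in> components F" "K' \<in> components F" "K \<noteq> K'"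
  obtains p p' L where "p \<in> K" "p' \<in> K'" "L \<ge> 1"
    "\<And>x y. x \<in> K \<Longrightarrow> y \<in> K' \<Longrightarrow> wdist T {x, y} = wdist F {x, p} + L + wdist F {p', y}"
proof -
  have T: "forest T" and sT: "simple_wgraph T"
    using leech_tree_forest[OF leech] by (auto simp: forest_def)
  have disj: "K \<inter> K' = {}" using components_eqI[OF K(1,2)] K(3) by blast
  let ?Q = "\<lambda>q. path T q \<and> hd q \<in> K \<and> last q \<in> K'"
  obtain x0 y0 where xy0: "x0 \<in> K" "y0 \<in> K'" using component_nonempty K by blast
  then have "joined T x0 y0"
    using component_subset K verts_eq leech_tree_joined[OF leech] by blast
  then have "\<exists>q. ?Q q" using xy0 unfolding joined_def by blast
  then obtain r where r: "path T r" "hd r \<in> K" "last r \<in> K'" and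
    min: "\<And>q. ?Q q \<Longrightarrow> length r \<le> length q"
    using ex_has_least_nat[of ?Q _ length] by metis
  obtain p r1 where "r = p # r1" using r(1) by (cases r) (auto simp: path_def)
  moreover from this obtain m p' where "r1 = m @ [p']"
    using r disj by (cases r1 rule: rev_cases) auto
  ultimately have rm: "r = p # m @ [p']" by simp
  have pp: "p \<in> K" "p' \<in> K'" using r rm by auto
  \<comment> \<open>An interior vertex in \<open>K\<close> would start a shorter path to
    \<open>p'\<close>, and one in \<open>K'\<close> would end a shorter path from
    \<open>p\<close>.\<close>
  have mK: "w \<notin> K \<and> w \<notin> K'" if w: "w \<in> set m" for w
  proof -
    obtain m1 m2 where m: "m = m1 @ w # m2" using w by (meson split_list)
    have "path T (p # m1 @ [w])" "path T (w # m2 @ [p'])"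
      using path_split[of T "p # m1" w "m2 @ [p']"] r(1) rm m by auto
    then show ?thesis
      using min[of "p # m1 @ [w]"] min[of "w # m2 @ [p']"] pp rm m by auto
  qed
  \<comment> \<open>The connecting path may pass through further components, so this offset need not
    be an edge weight.\<close>
  let ?L = "path_weight T (p # m @ [p'])"
  have "p \<noteq> p'" using pp disj by blast
  then have L: "?L \<ge> 1" using path_weight_pos[OF sT r(1)] rm by simp
  have "wdist T {x, y} = wdist F {x, p} + ?L + wdist F {p', y}" if xy: "x \<in> K" "y \<in> K'" for x y
  proof -
    have jx: "joined F x p" using component_mem[OF K(1) xy(1)] pp by blast
    have jy: "joined F p' y" using component_mem[OF K(2) pp(2)] xy by blast
    obtain s where s: "path F s" "hd s = x" "last s = p" using jx by (auto simp: joined_def)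
    obtain t where t: "path F t" "hd t = p'" "last t = y" using jy by (auto simp: joined_def)
    obtain s' where s': "s = s' @ [p]"
      using s by (cases s rule: rev_cases) (auto simp: path_def)
    obtain t' where t': "t = p' # t'" using t by (cases t) (auto simp: path_def)
    have sK: "set s' \<subseteq> K" using path_in_component[OF K(1) s(1)] s(2) xy s' by auto
    have tK: "set t' \<subseteq> K'" using path_in_component[OF K(2) t(1)] t(2) pp t' by auto
    have sT: "path T (s' @ [p])" and tT: "path T (p' # t')"
      using subgraph_path[OF sub s(1)] subgraph_path[OF sub t(1)] s' t' by auto
    \<comment> \<open>The part in \<open>K\<close>, the interior \<open>m\<close> and the part in
      \<open>K'\<close> share no vertex, so the three pieces glue to the path of \<open>T\<close>
      from \<open>x\<close> to \<open>y\<close>.\<close>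
    have "set (p # m) \<inter> set t' = {}" using tK mK pp disj by auto
    then have "path T ((p # m) @ p' # t')" using path_glue[of T "p # m" p' t'] r(1) rm tT by simp
    moreover have "set s' \<inter> set (m @ p' # t') = {}" using sK tK mK pp disj by auto
    ultimately have z: "path T (s' @ p # m @ p' # t')" using path_glue[OF sT] by simp
    have "hd (s' @ p # m @ p' # t') = x" using s s' by (cases s') auto
    moreover have "last (s' @ p # m @ p' # t') = y" using t t' by simp
    ultimately have "wdist T {x, y} = path_weight T (s' @ p # m @ p' # t')"
      using wdist_path[OF T z] by simp
    also have "\<dots> = path_weight T (s' @ [p]) + (?L + path_weight T (p' # t'))"
      using path_weight_glue[of T s' p "m @ p' # t'"] path_weight_glue[of T "p # m" p' t'] by simp
    also have "path_weight T (s' @ [p]) = wdist F {x, p}"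
      using wdist_path[OF T sT] wdist_eq[OF jx] s s' by simp
    also have "path_weight T (p' # t') = wdist F {p', y}"
      using wdist_path[OF T tT] wdist_eq[OF jy] t t' by simp
    finally show ?thesis by simp
  qed
  then show thesis using that[OF pp L] by blast
qed

end

section \<open>Blocks between components\<close>

definition cross_dists :: "'a wgraph \<Rightarrow> 'a set set \<Rightarrow> nat set" where
  "cross_dists T P = {wdist T {x, y} | x y. \<exists>K\<in>P. \<exists>K'\<in>P. K \<noteq> K' \<and> x \<in> K \<and> y \<in> K'}"

lemma cross_dists_pair:
  assumes "K \<noteq> K'"
  shows "cross_dists T {K, K'} = (\<lambda>(x, y). wdist T {x, y}) ` (K \<times> K')" (is "?L = ?R")
proof
  show "?L \<subseteq> ?R"
  proof
    fix d assume "d \<in> ?L"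
    then obtain x y where d: "d = wdist T {x, y}" and "x \<in> K \<and> y \<in> K' \<or> y \<in> K \<and> x \<in> K'"
      by (auto simp: cross_dists_def)
    then show "d \<in> ?R"
      by (elim disjE) (auto simp: insert_commute intro: rev_image_eqI)
  qed
  show "?R \<subseteq> ?L" using assms by (fastforce simp: cross_dists_def)
qed

text \<open>The gates of the two components give the shape of a block, distinctness of the distances
  of \<open>T\<close> gives its size, and pairs that are not joined in \<open>F\<close> have
  distances outside \<open>internal_dists F\<close>.\<close>

lemma cross_dists_candidate:
  assumes leech: "leech_tree 18 T" and sub: "subgraph F T" and P: "P \<in> component_pairs F"
  shows "cross_dists T P \<in> candidate_blocks F P"
proof -
  note v = verts_eq[OF leech sub]
  obtain K K' where PK: "P = {K, K'}" "K \<noteq> K'"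
    using P by (auto simp: component_pairs_def card_2_iff)
  then have K: "K \<in> components F" "K' \<in> components F" using P by (auto simp: component_pairs_def)
  have disj: "K \<inter> K' = {}" using components_eqI[OF K] PK by blast
  have KT: "K \<subseteq> verts T" "K' \<subseteq> verts T" using component_subset K v by blast+
  obtain p p' L where g: "p \<in> K" "p' \<in> K'" "L \<ge> 1"
    "\<And>x y. x \<in> K \<Longrightarrow> y \<in> K' \<Longrightarrow> wdist T {x, y} = wdist F {x, p} + L + wdist F {p', y}"
    using component_gates[OF leech sub K PK(2)] by blast
  let ?B = "(\<lambda>(x, y). wdist T {x, y}) ` (K \<times> K')"
  have "?B = {wdist T {x, y} | x y. x \<in> K \<and> y \<in> K'}" by auto
  also have "\<dots> = block F K K' p p' L"
    unfolding block_def by (rule Collect_cong) (metis g(4))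
  finally have block: "?B = block F K K' p p' L" .
  have "inj_on (\<lambda>(x, y). wdist T {x, y}) (K \<times> K')"
  proof (rule inj_onI; clarify)
    fix x y u v assume xy: "x \<in> K" "y \<in> K'" "u \<in> K" "v \<in> K'" and eq: "wdist T {x, y} = wdist T {u, v}"
    \<comment> \<open>The third inequality rules out that the two equal pairs are matched
      crosswise.\<close>
    have "x \<noteq> y" "u \<noteq> v" "x \<noteq> v" using xy disj by blast+
    then have "{x, y} = {u, v}" using leech_tree_wdist_inj[OF leech] xy KT eq by blast
    then show "x = u \<and> y = v" using \<open>x \<noteq> v\<close> by (auto simp: doubleton_eq_iff)
  qed
  then have card: "card ?B = card K * card K'" by (simp add: card_image card_cartesian_product)
  have sub153: "?B \<subseteq> {1..153} - internal_dists F"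
  proof
    fix d assume "d \<in> ?B"
    then obtain x y where xy: "x \<in> K" "y \<in> K'" "d = wdist T {x, y}" by auto
    then have "x \<in> verts T" "y \<in> verts T" "x \<noteq> y" using KT disj by blast+
    moreover have "\<not> joined F x y" using component_mem[OF K(1) xy(1)] xy(2) disj by blast
    ultimately show "d \<in> {1..153} - internal_dists F"
      using internal_dists_mem[OF leech sub] leech_tree_wdist_range[OF leech] xy(3) choose_18_2 by simp
  qed
  show ?thesis
    unfolding candidate_blocks_def PK(1) cross_dists_pair[OF PK(2)] mem_Collect_eq
    by (intro exI[of _ K] exI[of _ K'] exI[of _ p] exI[of _ p'] exI[of _ L] conjI)
      (rule refl | fact)+
qed

text \<open>A common value comes from a single vertex pair of \<open>T\<close>, and the components
  of its two vertices determine the component pair.\<close>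

lemma cross_dists_disjoint:
  assumes leech: "leech_tree n T" and sub: "subgraph F T"
  shows "disjoint_family_on (cross_dists T) (component_pairs F)"
proof (unfold disjoint_family_on_def, intro ballI impI)
  fix P P' assume P: "P \<in> component_pairs F" and P': "P' \<in> component_pairs F" and ne: "P \<noteq> P'"
  note v = verts_eq[OF leech sub]
  show "cross_dists T P \<inter> cross_dists T P' = {}"
  proof (rule ccontr)
    assume "cross_dists T P \<inter> cross_dists T P' \<noteq> {}"
    then obtain d where d: "d \<in> cross_dists T P" "d \<in> cross_dists T P'" by blast
    obtain x y K K' where x: "d = wdist T {x, y}" "K \<in> P" "K' \<in> P" "K \<noteq> K'" "x \<in> K" "y \<in> K'"
      using d(1) unfolding cross_dists_def by blast
    obtain u w M M' where u: "d = wdist T {u, w}" "M \<in> P'" "M' \<in> P'" "M \<noteq> M'" "u \<in> M" "w \<in> M'"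
      using d(2) unfolding cross_dists_def by blast
    have C: "K \<in> components F" "K' \<in> components F" "M \<in> components F" "M' \<in> components F"
      using P P' x u by (auto simp: component_pairs_def)
    have "x \<noteq> y" "u \<noteq> w" using components_eqI[OF C(1,2)] components_eqI[OF C(3,4)] x u by blast+
    moreover have "x \<in> verts T" "y \<in> verts T" "u \<in> verts T" "w \<in> verts T"
      using C x u component_subset v by blast+
    ultimately have "{x, y} = {u, w}" using leech_tree_wdist_inj[OF leech] x(1) u(1) by metis
    then consider "x = u" "y = w" | "x = w" "y = u" by (auto simp: doubleton_eq_iff)
    then have "{K, K'} = {M, M'}"
    proof cases
      case 1
      then have "K = M" "K' = M'"
        using components_eqI[OF C(1,3)] components_eqI[OF C(2,4)] x(5,6) u(5,6) by metis+
      then show ?thesis by simp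
    next
      case 2
      then have "K = M'" "K' = M"
        using components_eqI[OF C(1,4)] components_eqI[OF C(2,3)] x(5,6) u(5,6) by metis+
      then show ?thesis by auto
    qed
    moreover have "{A, B} = Q" if Q: "Q \<in> component_pairs F" "A \<in> Q" "B \<in> Q" "A \<noteq> B" for A B Q
    proof (rule card_subset_eq)
      have "card Q = 2" using Q(1) by (simp add: component_pairs_def)
      then show "finite Q" "card {A, B} = card Q" using Q(4) card_ge_0_finite by auto
    qed (use Q in simp)
    ultimately have "P = P'" using P P' x(2-4) u(2-4) by metis
    then show False using ne by simp
  qed
qed

text \<open>The family \<open>cross_dists T\<close> defeats both halves of the test: its members are
  candidates, and it is itself a disjoint choice, whatever \<open>decided\<close> says.\<close>

lemma not_block_test_rejects:
  assumes "leech_tree 18 T" "subgraph F T"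
  shows "\<not> block_test_rejects decided F"
proof -
  have "disjoint_blocks_exist F"
    unfolding disjoint_blocks_exist_def
    using cross_dists_candidate[OF assms] cross_dists_disjoint[OF assms]
    by (intro exI[of _ "cross_dists T"]) simp
  moreover have "\<not> (\<exists>P\<in>component_pairs F. candidate_blocks F P = {})"
    using cross_dists_candidate[OF assms] by fastforce
  ultimately show ?thesis by (simp add: block_test_rejects_def)
qed

subsection \<open>Parity\<close>

lemma card_odd_153: "card {k \<in> {1..153::nat}. odd k} = 77"
proof -
  have "{k \<in> {1..153::nat}. odd k} = (\<lambda>i. 2 * i + 1) ` {..<77}"
  proof (intro equalityI subsetI)
    fix k :: nat assume "k \<in> {k \<in> {1..153}. odd k}"
    then obtain i where "k = 2 * i + 1" "i < 77" by (auto elim!: oddE)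
    then show "k \<in> (\<lambda>i. 2 * i + 1) ` {..<77}" by blast
  qed auto
  moreover have "inj_on (\<lambda>i::nat. 2 * i + 1) {..<77}" by (auto intro: inj_onI)
  ultimately show ?thesis by (simp add: card_image)
qed

text \<open>The sizes are the roots of t^2 - 18 t + 77 = (t - 7)(t - 11). The computation is over
  the integers, where subtraction does not truncate.\<close>

lemma product_77:
  assumes "a + b = (18::nat)" "a * b = 77"
  shows "(a, b) \<in> {(7, 11), (11, 7)}"
proof -
  have b: "int b = 18 - int a" using assms(1) by linarith
  have "int a * int b = 77" using assms(2) by (metis of_nat_mult of_nat_numeral)
  then have "(int a - 7) * (int a - 11) = 0" unfolding b by (simp add: algebra_simps)
  then have "a = 7 \<or> a = 11" by auto
  then show ?thesis using assms(1) by auto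
qed

text \<open>Colour each vertex by the parity of its distance to \<open>r\<close>. By the triangle
  parity, the odd distances are exactly those between the colours, and each of the 77 odd numbers up
  to 153 occurs once, so the class sizes have product 77.\<close>

lemma leech_tree_parity_classes:
  assumes leech: "leech_tree 18 T"
  obtains c where "\<And>x y. x \<in> verts T \<Longrightarrow> y \<in> verts T \<Longrightarrow> even (wdist T {x, y}) \<longleftrightarrow> (c x \<longleftrightarrow> c y)"
    "(card (verts T \<inter> {x. c x}), card (verts T \<inter> {x. \<not> c x})) \<in> {(7, 11), (11, 7)}"
proof -
  have fin: "finite (verts T)" and card: "card (verts T) = 18"
    using leech by (auto simp: leech_tree_def tree_def forest_def simple_wgraph_def)
  obtain r where r: "r \<in> verts T" using leech by (auto simp: leech_tree_def tree_def)
  define c where "c x = even (wdist T {x, r})" for x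
  have c: "even (wdist T {x, y}) \<longleftrightarrow> (c x \<longleftrightarrow> c y)" if "x \<in> verts T" "y \<in> verts T" for x y
    using even_wdist_triangle[OF leech_tree_forest[OF leech], of x r y]
      leech_tree_joined[OF leech] that r unfolding c_def by auto
  let ?E = "verts T \<inter> {x. c x}" and ?O = "verts T \<inter> {x. \<not> c x}"
  let ?f = "\<lambda>(x, y). wdist T {x, y}"
  have "card ?E + card ?O = card (?E \<union> ?O)" using fin by (intro card_Un_disjoint[symmetric]) auto
  also have "?E \<union> ?O = verts T" by auto
  finally have sum: "card ?E + card ?O = 18" using card by simp
  have "inj_on ?f (?E \<times> ?O)"
  proof (rule inj_onI; clarify)
    fix x y u v
    assume v: "x \<in> verts T" "c x" "y \<in> verts T" "\<not> c y" "u \<in> verts T" "c u" "v \<in> verts T" "\<not> c v"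
      and eq: "wdist T {x, y} = wdist T {u, v}"
    then have "x \<noteq> y" "u \<noteq> v" "x \<noteq> v" by metis+
    then have "{x, y} = {u, v}" using leech_tree_wdist_inj[OF leech] v eq by blast
    then show "x = u \<and> y = v" using \<open>x \<noteq> v\<close> by (auto simp: doubleton_eq_iff)
  qed
  then have "card (?f ` (?E \<times> ?O)) = card ?E * card ?O"
    by (simp add: card_image card_cartesian_product)
  moreover have "?f ` (?E \<times> ?O) = {k \<in> {1..153}. odd k}"
  proof (intro equalityI subsetI)
    fix k assume "k \<in> ?f ` (?E \<times> ?O)"
    then obtain x y where x: "k = wdist T {x, y}" "x \<in> verts T" "c x" "y \<in> verts T" "\<not> c y" by auto
    then have "x \<noteq> y" by metis
    then show "k \<in> {k \<in> {1..153}. odd k}"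
      using x c[of x y] leech_tree_wdist_range[OF leech, of x y] choose_18_2 by simp
  next
    fix k :: nat assume k: "k \<in> {k \<in> {1..153}. odd k}"
    then have "k \<in> {1..18 choose 2}" using choose_18_2 by simp
    then obtain x y where x: "x \<in> verts T" "y \<in> verts T" "wdist T {x, y} = k"
      using leech_tree_wdist_surj[OF leech] by metis
    then have "c x \<noteq> c y" using c[of x y] k by simp
    then have "(x, y) \<in> ?E \<times> ?O \<or> (y, x) \<in> ?E \<times> ?O" using x by auto
    moreover have "k = ?f (x, y)" "k = ?f (y, x)" using x(3) by (simp_all add: insert_commute)
    ultimately show "k \<in> ?f ` (?E \<times> ?O)"
      using image_eqI[of k ?f "(x, y)"] image_eqI[of k ?f "(y, x)"] by blast
  qed
  ultimately have "card ?E * card ?O = 77" using card_odd_153 by simp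
  then show thesis using that[of c] c product_77[OF sum] by blast
qed

lemma parity_profile:
  assumes leech: "leech_tree 18 T" and sub: "subgraph F T"
  shows "parity_profile_possible F"
proof -
  note v = verts_eq[OF leech sub]
  obtain c where c: "\<And>x y. x \<in> verts T \<Longrightarrow> y \<in> verts T \<Longrightarrow> even (wdist T {x, y}) \<longleftrightarrow> (c x \<longleftrightarrow> c y)"
    and card: "(card (verts T \<inter> {x. c x}), card (verts T \<inter> {x. \<not> c x})) \<in> {(7, 11), (11, 7)}"
    using leech_tree_parity_classes[OF leech] by blast
  \<comment> \<open>The classes of \<open>K\<close> are taken relative to its fixed vertex; naming
    them by the colour of that vertex makes the first class the \<open>c\<close>-coloured part of
    every component.\<close>
  define s where "s K = c (SOME r. r \<in> K)" for K
  have cls: "parity_class F K b = K \<inter> {x. c x \<longleftrightarrow> (s K \<longleftrightarrow> b)}" if K: "K \<in> components F" for K b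
  proof -
    let ?r = "SOME r. r \<in> K"
    have r: "?r \<in> K" using component_nonempty[OF K] by (simp add: some_in_eq)
    have "even (wdist F {?r, x}) \<longleftrightarrow> (s K \<longleftrightarrow> c x)" if x: "x \<in> K" for x
    proof -
      have "joined F ?r x" using component_mem[OF K r] x by blast
      moreover have "?r \<in> verts T" "x \<in> verts T" using component_subset[OF K] r x v by auto
      ultimately show ?thesis using c[of ?r x] wdist_eq[OF leech sub] unfolding s_def by simp
    qed
    then show ?thesis unfolding parity_class_def by auto
  qed
  have fin: "finite (verts F)" using finite_verts[OF leech sub] v by simp
  have "(\<Sum>K\<in>components F. card (parity_class F K (s K))) = card (verts T \<inter> {x. c x})"
    using sum_card_components[OF fin, of "{x. c x}"] cls v by simp
  moreover have "(\<Sum>K\<in>components F. card (parity_class F K (\<not> s K))) = card (verts T \<inter> {x. \<not> c x})"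
    using sum_card_components[OF fin, of "{x. \<not> c x}"] cls v by simp
  ultimately show ?thesis
    unfolding parity_profile_possible_def using card by (intro exI[of _ s]) simp
qed

subsection \<open>Long paths\<close>

text \<open>The bound is twice 1 + ... + k for k elements. Removing the maximum, which is at least
  the cardinality, reduces to a smaller set.\<close>

lemma sum_distinct_positive_ge:
  fixes S :: "int set"
  assumes "finite S" "S \<subseteq> {0<..}"
  shows "int (card S) * (int (card S) + 1) \<le> 2 * \<Sum>S"
  using assms
proof (induction "card S" arbitrary: S)
  case (Suc k)
  then have ne: "S \<noteq> {}" by auto
  let ?m = "Max S"
  have m: "?m \<in> S" using Suc.prems ne by simp
  have "S \<subseteq> {1..?m}" using Suc.prems by auto
  then have "card S \<le> card {1..?m}" by (intro card_mono) auto
  then have le: "int (Suc k) \<le> ?m" using Suc.hyps(2) by simp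
  have k: "card (S - {?m}) = k" using Suc m by simp
  then have "int k * (int k + 1) \<le> 2 * \<Sum>(S - {?m})"
    using Suc.hyps(1)[of "S - {?m}"] Suc.prems by auto
  moreover have "\<Sum>S = ?m + \<Sum>(S - {?m})" using m Suc.prems by (simp add: sum.remove)
  ultimately have "int k * (int k + 1) + 2 * int (Suc k) \<le> 2 * \<Sum>S" using le by (simp add: algebra_simps)
  then show ?case unfolding Suc.hyps(2)[symmetric] by (simp add: algebra_simps)
qed simp

text \<open>
  The 42 differences between marks at most three steps apart are distinct, so their sum is at
  least 903. Each of the three step sizes telescopes, which gives \<open>6 L\<close> less the end gaps:
  the outermost gap on either side is lost three times and the next one once.
\<close>

lemma golomb_ruler_16:
  fixes x :: "nat \<Rightarrow> int"
  assumes mono: "\<And>i j. i < j \<Longrightarrow> j < 16 \<Longrightarrow> x i < x j"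
    and inj: "inj_on (\<lambda>(i, j). x j - x i) {(i, j). i < j \<and> j < 16}"
  shows "x 15 - x 0 \<ge> 154"
proof -
  let ?d = "\<lambda>(i, j). x j - x i"
  have sum_ge: "int (card A) * (int (card A) + 1) \<le> 2 * (\<Sum>p\<in>A. ?d p)"
    if A: "finite A" "A \<subseteq> {(i, j). i < j \<and> j < 16}" for A
  proof -
    have i: "inj_on ?d A" using inj A(2) by (rule inj_on_subset)
    have "?d ` A \<subseteq> {0<..}" using A(2) mono by auto
    then show ?thesis
      using sum_distinct_positive_ge[of "?d ` A"] A(1) card_image[OF i] sum.reindex[OF i, of id]
      by simp
  qed
  \<comment> \<open>Step size \<open>k\<close> has \<open>16 - k\<close> starting marks, in all 15 +
    14 + 13 = 42 differences.\<close>
  let ?S = "SIGMA k:{1, 2, 3::nat}. {..<16 - k}" and ?g = "\<lambda>(k, i). (i, i + k)"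
  have g: "inj_on ?g ?S" by (auto intro!: inj_onI)
  have "int (card (?g ` ?S)) * (int (card (?g ` ?S)) + 1) \<le> 2 * (\<Sum>p\<in>?g ` ?S. ?d p)"
    by (rule sum_ge) auto
  moreover have "card (?g ` ?S) = 42" using card_image[OF g] by simp
  moreover have "(\<Sum>p\<in>?g ` ?S. ?d p) = (\<Sum>k\<in>{1, 2, 3}. \<Sum>i<16 - k. x (i + k) - x i)"
    unfolding sum.reindex[OF g] by (simp add: sum.Sigma case_prod_beta o_def)
  moreover have "\<dots> = 6 * (x 15 - x 0) - 3 * ((x 1 - x 0) + (x 15 - x 14)) - ((x 2 - x 1) + (x 14 - x 13))"
    by (simp add: eval_nat_numeral)
  ultimately have main: "903 \<le> 6 * (x 15 - x 0) - 3 * ((x 1 - x 0) + (x 15 - x 14)) - ((x 2 - x 1) + (x 14 - x 13))"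
    by simp
  have "3 \<le> (x 1 - x 0) + (x 15 - x 14)"
    using sum_ge[of "{(0, 1), (14, 15)}"] by simp
  moreover have "10 \<le> ((x 1 - x 0) + (x 15 - x 14)) + ((x 2 - x 1) + (x 14 - x 13))"
    using sum_ge[of "{(0, 1), (14, 15), (1, 2), (13, 14)}"] by simp
  \<comment> \<open>Here 6 L is at least 903 + 2 s + (s + t), hence at least 919, one more than 6 *
    153.\<close>
  moreover have "154 \<le> L" if "903 \<le> 6 * L - 3 * s - t" "3 \<le> s" "10 \<le> s + t" for L s t :: int
    using that by presburger
  ultimately show ?thesis using main by blast
qed

text \<open>Weights of initial segments will be the marks of the ruler. The segment ending at vertex
  \<open>i\<close> has \<open>Suc i\<close> vertices.\<close>

lemma path_weight_take:
  assumes G: "forest G" and p: "path G p" and ij: "i < j" "j < length p"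
  shows "path_weight G (take (Suc j) p) = path_weight G (take (Suc i) p) + wdist G {p ! i, p ! j}"
proof -
  let ?q = "take (Suc j) p"
  have "p = take j p @ p ! j # drop (Suc j) p" using ij(2) by (rule id_take_nth_drop)
  then have q: "path G ?q"
    using path_split(1)[of G "take j p" "p ! j" "drop (Suc j) p"] p ij(2)
    by (simp add: take_Suc_conv_app_nth)
  have "i < length ?q" using ij by simp
  then obtain r where "?q = take i ?q @ ?q ! i # r" using id_take_nth_drop by blast
  moreover have "take i ?q = take i p" "?q ! i = p ! i" using ij by (simp_all add: min_def)
  ultimately have s: "?q = take i p @ p ! i # r" by metis
  have "last (p ! i # r) = last ?q" unfolding s by simp
  also have "\<dots> = p ! j" using ij(2) by (simp add: take_Suc_conv_app_nth)
  finally have "wdist G {p ! i, p ! j} = path_weight G (p ! i # r)"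
    using wdist_path[OF G path_split(2)[OF q[unfolded s]]] by simp
  moreover have "path_weight G ?q = path_weight G (take i p @ [p ! i]) + path_weight G (p ! i # r)"
    unfolding s by (rule path_weight_glue)
  ultimately show ?thesis using ij by (simp add: take_Suc_conv_app_nth[of i])
qed

text \<open>The first 16 vertices of a longer path would be a Golomb ruler whose full length is a
  distance of \<open>T\<close>, hence at most 153. Vertices are counted here, so the bound means at
  most 14 edges.\<close>

lemma leech_tree_path_length:
  assumes leech: "leech_tree 18 T" and p: "path T p"
  shows "length p < 16"
proof (rule ccontr)
  assume "\<not> length p < 16"
  then have len: "16 \<le> length p" by simp
  have dist: "distinct p" and pv: "\<And>i. i < 16 \<Longrightarrow> p ! i \<in> verts T"
    using p len by (auto simp: path_def)
  have ne: "p ! i \<noteq> p ! j" if "i < j" "j < 16" for i j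
    using dist len that by (simp add: nth_eq_iff_index_eq)
  define x where "x i = int (path_weight T (take (Suc i) p))" for i
  have diff: "x j - x i = int (wdist T {p ! i, p ! j})" if "i < j" "j < 16" for i j
    using path_weight_take[OF leech_tree_forest[OF leech] p that(1)] that(2) len
    unfolding x_def by simp
  have range: "wdist T {p ! i, p ! j} \<in> {1..153}" if "i < j" "j < 16" for i j
    using leech_tree_wdist_range[OF leech pv pv ne[OF that]] that choose_18_2 by simp
  have "154 \<le> x 15 - x 0"
  proof (rule golomb_ruler_16)
    fix i j :: nat assume "i < j" "j < 16"
    then show "x i < x j" using diff[of i j] range[of i j] by simp
  next
    show "inj_on (\<lambda>(i, j). x j - x i) {(i, j). i < j \<and> j < 16}"
    proof (rule inj_onI; clarify)
      fix i j k l :: nat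
      assume ij: "i < j" "j < 16" and kl: "k < l" "l < 16" and "x j - x i = x l - x k"
      then have "wdist T {p ! i, p ! j} = wdist T {p ! k, p ! l}" using diff by simp
      then have "{p ! i, p ! j} = {p ! k, p ! l}"
        using leech_tree_wdist_inj[OF leech pv pv pv pv ne[OF ij] ne[OF kl]] ij kl by simp
      then show "i = k \<and> j = l"
        using dist len ij kl by (auto simp: doubleton_eq_iff nth_eq_iff_index_eq)
    qed
  qed
  then show False using diff[of 0 15] range[of 0 15] by simp
qed

lemma not_has_long_path:
  assumes "leech_tree 18 T" "subgraph F T"
  shows "\<not> has_long_path F"
proof -
  have "length p - 1 \<le> 14" if "path F p" for p
    using leech_tree_path_length[OF assms(1) subgraph_path[OF assms(2) that]] by simp
  then show ?thesis unfolding has_long_path_def by (meson not_le)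
qed

section \<open>The search\<close>

lemma not_rejected:
  assumes "leech_tree 18 T" "subgraph F T"
  shows "\<not> rejected decided F"
  using inj_on_internal_pairs[OF assms] internal_dists_range[OF assms] parity_profile[OF assms]
    not_has_long_path[OF assms] not_block_test_rejects[OF assms] choose_18_2
  by (simp add: rejected_def)

lemma search_stateI:
  assumes "leech_tree 18 T" "subgraph F T" "verts F = {..<18}"
  shows "search_state F"
  using inj_on_internal_pairs[OF assms(1,2)] internal_dists_range[OF assms(1,2)] assms(3)
    subgraph_forest[OF assms(2) leech_tree_forest[OF assms(1)]] choose_18_2
  by (simp add: search_state_def)

text \<open>Hence \<open>extend\<close> never overwrites a weight, and each step raises the number
  of edges by exactly one.\<close>

lemma candidate_not_edge:
  assumes F: "simple_wgraph F" and e: "e \<in> candidates F"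
  shows "e \<notin> edges F"
proof
  obtain u v K K' where *: "e = {u, v}" "K \<in> components F" "K' \<in> components F" "K \<noteq> K'" "u \<in> K" "v \<in> K'"
    using e unfolding candidates_def by blast
  assume "e \<in> edges F"
  then have "joined F u v" using joined_edge[OF F] *(1) by simp
  then have "v \<in> K" using component_mem[OF *(2,5)] by simp
  then show False using components_eqI[OF *(2,3)] * by blast
qed

text \<open>
  The retained representative of the forced edge of \<open>T\<close> lies in the image of \<open>T\<close> under an
  automorphism of \<open>F\<close>, which again contains \<open>F\<close>.
\<close>

lemma retained_extension:
  assumes leech: "leech_tree 18 T" and sub: "subgraph F T" and ne: "edges F \<noteq> edges T"
    and R: "orbit_representatives F R"
  obtains e T' where "e \<in> R" "leech_tree 18 T'" "subgraph (extend F e) T'"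
    "card (edges (extend F e)) = Suc (card (edges F))"
proof -
  note v = verts_eq[OF leech sub]
  obtain a b where ab: "a \<in> verts T" "b \<in> verts T" "\<not> joined F a b"
    "wt T {a, b} = Some (forced_weight F)"
    using forced_edge[OF leech sub ne] .
  obtain K where K: "K \<in> components F" "a \<in> K" using in_some_component[of a F] ab v by blast
  obtain K' where K': "K' \<in> components F" "b \<in> K'" using in_some_component[of b F] ab v by blast
  have "K \<noteq> K'" using component_mem[OF K] K' ab(3) by blast
  then have "{a, b} \<in> candidates F" unfolding candidates_def using K K' by blast
  then obtain e where e: "e \<in> R" "e \<in> orbit F {a, b}"
    using R unfolding orbit_representatives_def by blast
  obtain f where f: "e = f ` {a, b}" "isomorphism f F F" using e(2) by (auto simp: orbit_def)
  note T' = leech_tree_relabel[OF leech sub f(2) simple_subgraph[OF leech sub]]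
  let ?T' = "relabel f T"
  have "inj_on f (verts T)" using f(2) v by (simp add: isomorphism_def bij_betw_def)
  then have "wt ?T' e = Some (forced_weight F)" using wt_relabel[of f T a b] ab f(1) by simp
  then have sub': "subgraph (extend F e) ?T'"
    using T'(2) by (auto simp: subgraph_def extend_def map_le_def)
  have "e \<notin> edges F"
    using candidate_not_edge[OF simple_subgraph[OF leech sub]] e(1) R by (auto simp: orbit_representatives_def)
  moreover have "finite (edges F)"
  proof (rule finite_subset)
    show "edges F \<subseteq> Pow (verts F)" using simple_subgraph[OF leech sub] by (auto simp: simple_wgraph_def)
    show "finite (Pow (verts F))" using finite_verts[OF leech sub] v by simp
  qed
  ultimately have "card (edges (extend F e)) = Suc (card (edges F))"
    by (simp add: extend_def edges_def)
  then show thesis using that e(1) T'(1) sub' by blast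
qed

lemma search_reaches_leaf:
  assumes reps: "\<And>F. search_state F \<Longrightarrow> card (edges F) < 17 \<Longrightarrow> orbit_representatives F (retained F)"
    and "reached retained decided C F" "leech_tree 18 T" "subgraph F T" "verts F = {..<18}"
    and "card (edges F) \<le> 17"
  shows "\<exists>F. reached retained decided C F \<and> accepting_leaf F"
  using assms(2-)
\<comment> \<open>\<open>T\<close> varies with \<open>F\<close>: the retained child may fit only
  into an image of the current tree.\<close>
proof (induction "17 - card (edges F)" arbitrary: F T)
  case 0
  then have "accepting_leaf F" using search_stateI by (simp add: accepting_leaf_def)
  then show ?case using 0 by blast
next
  case (Suc k)
  then have lt: "card (edges F) < 17" by simp
  have "tree T" "card (verts T) = 18" using Suc.prems(2) by (auto simp: leech_tree_def)
  \<comment> \<open>\<open>T\<close> has at least 17 edges, so some edge of it is still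
    missing.\<close>
  then have "edges F \<noteq> edges T" using tree_edges_ge[of T] lt by auto
  then obtain e T' where e: "e \<in> retained F" "leech_tree 18 T'" "subgraph (extend F e) T'"
    "card (edges (extend F e)) = Suc (card (edges F))"
    using retained_extension[OF Suc.prems(2,3)] reps[OF search_stateI[OF Suc.prems(2-4)] lt] by metis
  have "reached retained decided C (extend F e)"
    using reached.child[OF Suc.prems(1) lt e(1)] not_rejected[OF e(2,3)] by blast
  then show ?case
    using Suc.hyps(1)[OF _ _ e(2,3)] Suc.hyps(2) Suc.prems(4) e(4) lt by (simp add: extend_def)
qed

section \<open>The configurations as roots\<close>

lemma forest18_simple:
  assumes "\<And>u v k. (u, v, k) \<in> set es \<Longrightarrow> u < 18 \<and> v < 18 \<and> u \<noteq> v \<and> 0 < k"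
  shows "simple_wgraph (forest18 es)"
proof -
  have "\<exists>u\<in>{..<18}. \<exists>v\<in>{..<18}. u \<noteq> v \<and> e = {u, v} \<and> 0 < the (wt (forest18 es) e)"
    if e: "e \<in> edges (forest18 es)" for e
  proof -
    obtain k where k: "wt (forest18 es) e = Some k" using e by (auto simp: edges_def)
    then have "(e, k) \<in> set (map (\<lambda>(u, v, k). ({u, v}, k)) es)"
      by (intro map_of_SomeD) (simp add: forest18_def)
    then obtain u v where "(u, v, k) \<in> set es" "e = {u, v}" by auto
    then show ?thesis using assms[of u v k] k by auto
  qed
  moreover have "verts (forest18 es) = {..<18}" by (simp add: forest18_def)
  ultimately show ?thesis unfolding simple_wgraph_def by (metis finite_lessThan)
qed

lemma forest18_card_edges: "card (edges (forest18 es)) \<le> length es"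
proof -
  have "edges (forest18 es) = (\<lambda>(u, v, k). {u, v}) ` set es"
    by (force simp: edges_def forest18_def dom_map_of_conv_image_fst)
  then have "card (edges (forest18 es)) \<le> card (set es)" by (simp add: card_image_le)
  also have "\<dots> \<le> length es" by (rule card_length)
  finally show ?thesis .
qed

lemma configuration_simple: "C \<in> configurations \<Longrightarrow> simple_wgraph C"
  by (auto simp: configurations_def) (rule forest18_simple; auto)+

lemma configuration_card_edges: "C \<in> configurations \<Longrightarrow> card (edges C) \<le> 17"
proof -
  assume "C \<in> configurations"
  then obtain es where "C = forest18 es" "length es = 3" unfolding configurations_def by fastforce
  then show ?thesis using forest18_card_edges[of es] by simp
qed

theorem proposition5p3:
  fixes C :: "nat wgraph"
    and retained :: "nat wgraph \<Rightarrow> nat set set"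
    and decided :: "nat wgraph \<Rightarrow> bool"
  assumes "C \<in> configurations"
    and "\<And>F. search_state F \<Longrightarrow> card (edges F) < 17 \<Longrightarrow> orbit_representatives F (retained F)"
    and "\<exists>(T :: 'a wgraph) H. leech_tree 18 T \<and> smallest_edges 3 T H \<and> isomorphic H C"
  shows "\<exists>F. reached retained decided C F \<and> accepting_leaf F"
proof -
  obtain T :: "'a wgraph" and H f where T: "leech_tree 18 T" "smallest_edges 3 T H" "isomorphism f H C"
    using assms(3) unfolding isomorphic_def by blast
  have sub: "subgraph H T"
    using T(2) by (auto simp: smallest_edges_def subgraph_def map_le_def restrict_map_def split: if_splits)
  have "verts C = {..<18}" using assms(1) by (auto simp: configurations_def forest18_def)
  \<comment> \<open>Relabelling along \<open>f\<close> moves \<open>T\<close> onto the vertex set of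
    \<open>C\<close>, with \<open>C\<close> as a subgraph; this starts the induction at the
    root.\<close>
  then show ?thesis
    using search_reaches_leaf[OF assms(2) reached.root
      leech_tree_relabel(1,2)[OF T(1) sub T(3) configuration_simple[OF assms(1)]]]
      configuration_card_edges[OF assms(1)] by blast
qed

end
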